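(* Let $R$ be a ring and let $M$ be a left $R$-module which is projective in $\sigma[M]$. If $M$ is a prime Goldie module and co-semisimple, then $M$ is $FI$-simple.
   Context: Rings are associative with unit and modules are left unital modules. $\sigma[M]$ is the full subcategory of $R$-Mod of $M$-subgenerated modules (submodules of quotients of direct sums of copies of $M$). "Projective in $\sigma[M]$" means that $\mathrm{Hom}_R(M,-)$ is exact on short exact sequences in $\sigma[M]$. A module $A$ is $M$-injective if every homomorphism from a submodule of $M$ to $A$ extends to $M$. $M$ is co-semisimple if every simple module in $\sigma[M]$ is $M$-injective. A submodule $N\le M$ is fully invariant, $N\leq_{FI}M$, if $f(N)\le N$ for all $f\in \mathrm{End}_R(M)$. $M$ is $FI$-simple if it has no nonzero proper fully invariant submodules. For $N,K\le M$, the product is $N_MK=\sum\{f(N)\mid f\in \mathrm{Hom}_R(M,K)\}$. A proper submodule $P\leq_{FI}M$ is prime in $M$ if whenever $N,K\leq_{FI}M$ and $N_MK\le P$, then $N\le P$ or $K\le P$; $M$ is a prime module if $0$ is prime in $M$. A left annihilator in $M$ is a submodule of the form $\bigcap_{f\in X}\mathrm{Ker}(f)$ for some $X\subseteq \mathrm{End}_R(M)$. $M$ is a Goldie module if it satisfies ACC on left annihilators and has finite uniform dimension. *)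

theory Defs
  imports "HOL-Algebra.Module" "HOL-Algebra.AbelCoset"
begin

text \<open>
  The library locale \<^locale>\<open>module\<close> requires a commutative ring of scalars; the following is
  its variant over an arbitrary associative ring with unit. The library locale
  \<^locale>\<open>submodule\<close> makes no commutativity assumption and is used as it is.
\<close>

locale left_module = R?: ring R + M?: abelian_group M
  for R :: "('r, 'z) ring_scheme" (structure) and M :: "('r, 'm, 'w) module_scheme" (structure) +
  assumes smult_closed [simp, intro]:
      "\<lbrakk>a \<in> carrier R; x \<in> carrier M\<rbrakk> \<Longrightarrow> a \<odot>\<^bsub>M\<^esub> x \<in> carrier M"
    and smult_l_distr:
      "\<lbrakk>a \<in> carrier R; b \<in> carrier R; x \<in> carrier M\<rbrakk> \<Longrightarrow>
      (a \<oplus>\<^bsub>R\<^esub> b) \<odot>\<^bsub>M\<^esub> x = a \<odot>\<^bsub>M\<^esub> x \<oplus>\<^bsub>M\<^esub> b \<odot>\<^bsub>M\<^esub> x"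
    and smult_r_distr:
      "\<lbrakk>a \<in> carrier R; x \<in> carrier M; y \<in> carrier M\<rbrakk> \<Longrightarrow>
      a \<odot>\<^bsub>M\<^esub> (x \<oplus>\<^bsub>M\<^esub> y) = a \<odot>\<^bsub>M\<^esub> x \<oplus>\<^bsub>M\<^esub> a \<odot>\<^bsub>M\<^esub> y"
    and smult_assoc1:
      "\<lbrakk>a \<in> carrier R; b \<in> carrier R; x \<in> carrier M\<rbrakk> \<Longrightarrow>
      (a \<otimes>\<^bsub>R\<^esub> b) \<odot>\<^bsub>M\<^esub> x = a \<odot>\<^bsub>M\<^esub> (b \<odot>\<^bsub>M\<^esub> x)"
    and smult_one [simp]:
      "x \<in> carrier M \<Longrightarrow> \<one>\<^bsub>R\<^esub> \<odot>\<^bsub>M\<^esub> x = x"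

text \<open>As for \<^const>\<open>hom\<close>, the values of a homomorphism outside the carrier are irrelevant.\<close>

definition module_hom ::
  "('r, 'z) ring_scheme \<Rightarrow> ('r, 'a, 'v) module_scheme \<Rightarrow> ('r, 'b, 'w) module_scheme \<Rightarrow> ('a \<Rightarrow> 'b) set"
  where "module_hom R A B = {f \<in> hom (add_monoid A) (add_monoid B).
    \<forall>r\<in>carrier R. \<forall>x\<in>carrier A. f (r \<odot>\<^bsub>A\<^esub> x) = r \<odot>\<^bsub>B\<^esub> f x}"

abbreviation module_End :: "('r, 'z) ring_scheme \<Rightarrow> ('r, 'm, 'w) module_scheme \<Rightarrow> ('m \<Rightarrow> 'm) set"
  where "module_End R M \<equiv> module_hom R M M"

definition simple_module :: "('r, 'z) ring_scheme \<Rightarrow> ('r, 'm, 'w) module_scheme \<Rightarrow> bool"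
  where "simple_module R M \<longleftrightarrow> left_module R M \<and> carrier M \<noteq> {\<zero>\<^bsub>M\<^esub>} \<and>
    (\<forall>N. submodule N R M \<longrightarrow> N = {\<zero>\<^bsub>M\<^esub>} \<or> N = carrier M)"

definition submodule_sum ::
  "('r, 'z) ring_scheme \<Rightarrow> ('r, 'm, 'w) module_scheme \<Rightarrow> 'm set set \<Rightarrow> 'm set"
  where "submodule_sum R M \<N> = \<Inter>{H. submodule H R M \<and> \<Union>\<N> \<subseteq> H}"


text \<open>
  The ring components \<^const>\<open>mult\<close> and \<^const>\<open>one\<close> of a module record carry no meaning.
\<close>

definition direct_power ::
  "('r, 'm, 'w) module_scheme \<Rightarrow> 'i set \<Rightarrow> ('r, 'i \<Rightarrow> 'm) module"
  where "direct_power M I =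
    \<lparr>carrier = {x \<in> I \<rightarrow>\<^sub>E carrier M. finite {i \<in> I. x i \<noteq> \<zero>\<^bsub>M\<^esub>}},
     mult = undefined, one = undefined,
     zero = (\<lambda>i\<in>I. \<zero>\<^bsub>M\<^esub>),
     add = (\<lambda>x y. \<lambda>i\<in>I. x i \<oplus>\<^bsub>M\<^esub> y i),
     smult = (\<lambda>r x. \<lambda>i\<in>I. r \<odot>\<^bsub>M\<^esub> x i)\<rparr>"

definition quotient_module ::
  "('r, 'm, 'w) module_scheme \<Rightarrow> 'm set \<Rightarrow> ('r, 'm set) module"
  where "quotient_module M N =
    \<lparr>carrier = a_rcosets\<^bsub>M\<^esub> N,
     mult = undefined, one = undefined,
     zero = N,
     add = set_add M,
     smult = (\<lambda>r X. \<Union>x\<in>X. N +>\<^bsub>M\<^esub> (r \<odot>\<^bsub>M\<^esub> x))\<rparr>"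

text \<open>
  \<open>A\<close> is an object of \<open>\<sigma>[M]\<close> iff it embeds into a quotient of a direct sum of copies of \<open>M\<close>.
  Index sets inside \<^typ>\<open>'a \<times> nat\<close> cover arbitrary index sets: given an embedding of \<open>A\<close> into
  \<open>M\<^bsup>(J)\<^esup> / K\<close>, choose a (finitely supported) representative of the image of each element of \<open>A\<close>;
  the union \<open>I\<close> of the supports injects into \<open>A \<times> \<nat>\<close>, and \<open>A\<close> embeds into
  \<open>M\<^bsup>(I)\<^esup> / (K \<inter> M\<^bsup>(I)\<^esup>)\<close>.
\<close>

definition in_sigma ::
  "('r, 'z) ring_scheme \<Rightarrow> ('r, 'm, 'w) module_scheme \<Rightarrow> ('r, 'a, 'v) module_scheme \<Rightarrow> bool"
  where "in_sigma R M A \<longleftrightarrow> left_module R A \<and>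
    (\<exists>(I :: ('a \<times> nat) set) K e. submodule K R (direct_power M I) \<and>
      e \<in> module_hom R A (quotient_module (direct_power M I) K) \<and> inj_on e (carrier A))"

text \<open>
  HOL cannot quantify over all types inside a formula, so "for all modules in \<open>\<sigma>[M]\<close>" is
  rendered by quantifying over all module structures on subsets of the type below, whose
  cardinality exceeds \<open>max(|R|, |M|, \<aleph>\<^sub>0)\<close>. No generality is lost:
  \<^item> Every simple module in \<open>\<sigma>[M]\<close> is a quotient of \<open>R\<close>, hence of cardinality at most \<open>|R|\<close>.
  \<^item> Let \<open>p : B \<rightarrow> C\<close> be an epimorphism in \<open>\<sigma>[M]\<close>, in arbitrary types, and \<open>f : M \<rightarrow> C\<close>. Choosing
    a preimage in \<open>B\<close> of each \<open>f x\<close> and letting \<open>B'\<close> be the submodule they generate, one gets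
    \<open>|B'| \<le> max(|R|, |M|, \<aleph>\<^sub>0)\<close> and \<open>f M \<subseteq> p B'\<close>, so that a lifting of \<open>f\<close> along
    \<open>B' \<rightarrow> p B'\<close>, a morphism representable in the type below, is a lifting of \<open>f\<close> along \<open>p\<close>.
    (The other parts of exactness of \<open>Hom(M, -)\<close> hold for every \<open>M\<close>.)
\<close>

type_synonym ('r, 'm) sigma_univ = "(nat \<times> 'r \<times> 'm) set"

definition short_exact ::
  "('r, 'z) ring_scheme \<Rightarrow> ('r, 'a, 'u) module_scheme \<Rightarrow> ('r, 'b, 'v) module_scheme \<Rightarrow>
    ('r, 'c, 'w) module_scheme \<Rightarrow> ('a \<Rightarrow> 'b) \<Rightarrow> ('b \<Rightarrow> 'c) \<Rightarrow> bool"
  where "short_exact R A B C j p \<longleftrightarrow>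
    j \<in> module_hom R A B \<and> p \<in> module_hom R B C \<and>
    inj_on j (carrier A) \<and> j ` carrier A = a_kernel B C p \<and> p ` carrier B = carrier C"


text \<open>Exactness of \<open>0 \<rightarrow> Hom(M, A) \<rightarrow> Hom(M, B) \<rightarrow> Hom(M, C) \<rightarrow> 0\<close>:\<close>

definition Hom_short_exact ::
  "('r, 'z) ring_scheme \<Rightarrow> ('r, 'm, 't) module_scheme \<Rightarrow> ('r, 'a, 'u) module_scheme \<Rightarrow>
    ('r, 'b, 'v) module_scheme \<Rightarrow> ('r, 'c, 'w) module_scheme \<Rightarrow> ('a \<Rightarrow> 'b) \<Rightarrow> ('b \<Rightarrow> 'c) \<Rightarrow> bool"
  where "Hom_short_exact R M A B C j p \<longleftrightarrow>
    (\<forall>g\<in>module_hom R M A. \<forall>h\<in>module_hom R M A.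
      (\<forall>x\<in>carrier M. j (g x) = j (h x)) \<longrightarrow> (\<forall>x\<in>carrier M. g x = h x)) \<and>
    (\<forall>g\<in>module_hom R M B.
      (\<exists>h\<in>module_hom R M A. \<forall>x\<in>carrier M. g x = j (h x)) \<longleftrightarrow>
      (\<forall>x\<in>carrier M. p (g x) = \<zero>\<^bsub>C\<^esub>)) \<and>
    (\<forall>f\<in>module_hom R M C. \<exists>g\<in>module_hom R M B. \<forall>x\<in>carrier M. f x = p (g x))"

definition projective_in_sigma :: "('r, 'z) ring_scheme \<Rightarrow> ('r, 'm, 'w) module_scheme \<Rightarrow> bool"
  where "projective_in_sigma R M \<longleftrightarrow>
    (\<forall>(A :: ('r, ('r, 'm) sigma_univ) module) (B :: ('r, ('r, 'm) sigma_univ) module)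
      (C :: ('r, ('r, 'm) sigma_univ) module) j p.
      in_sigma R M A \<and> in_sigma R M B \<and> in_sigma R M C \<and> short_exact R A B C j p \<longrightarrow>
      Hom_short_exact R M A B C j p)"

definition rel_injective ::
  "('r, 'z) ring_scheme \<Rightarrow> ('r, 'm, 'w) module_scheme \<Rightarrow> ('r, 'a, 'v) module_scheme \<Rightarrow> bool"
  where "rel_injective R M A \<longleftrightarrow>
    (\<forall>N. submodule N R M \<longrightarrow> (\<forall>f\<in>module_hom R (M\<lparr>carrier := N\<rparr>) A.
      \<exists>g\<in>module_hom R M A. \<forall>x\<in>N. g x = f x))"

definition cosemisimple :: "('r, 'z) ring_scheme \<Rightarrow> ('r, 'm, 'w) module_scheme \<Rightarrow> bool"
  where "cosemisimple R M \<longleftrightarrow>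
    (\<forall>S :: ('r, ('r, 'm) sigma_univ) module.
      in_sigma R M S \<and> simple_module R S \<longrightarrow> rel_injective R M S)"


definition fully_invariant ::
  "('r, 'z) ring_scheme \<Rightarrow> ('r, 'm, 'w) module_scheme \<Rightarrow> 'm set \<Rightarrow> bool"
  where "fully_invariant R M N \<longleftrightarrow> submodule N R M \<and> (\<forall>f\<in>module_End R M. f ` N \<subseteq> N)"

definition FI_simple :: "('r, 'z) ring_scheme \<Rightarrow> ('r, 'm, 'w) module_scheme \<Rightarrow> bool"
  where "FI_simple R M \<longleftrightarrow>
    \<not> (\<exists>N. fully_invariant R M N \<and> N \<noteq> {\<zero>\<^bsub>M\<^esub>} \<and> N \<noteq> carrier M)"

text \<open>The product \<open>N\<^sub>M K\<close> of submodules \<open>N\<close>, \<open>K\<close> of \<open>M\<close>:\<close>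

definition submodule_product ::
  "('r, 'z) ring_scheme \<Rightarrow> ('r, 'm, 'w) module_scheme \<Rightarrow> 'm set \<Rightarrow> 'm set \<Rightarrow> 'm set"
  where "submodule_product R M N K =
    submodule_sum R M {f ` N | f. f \<in> module_hom R M (M\<lparr>carrier := K\<rparr>)}"

definition prime_submodule ::
  "('r, 'z) ring_scheme \<Rightarrow> ('r, 'm, 'w) module_scheme \<Rightarrow> 'm set \<Rightarrow> bool"
  where "prime_submodule R M P \<longleftrightarrow> fully_invariant R M P \<and> P \<noteq> carrier M \<and>
    (\<forall>N K. fully_invariant R M N \<and> fully_invariant R M K \<and> submodule_product R M N K \<subseteq> P \<longrightarrow>
      N \<subseteq> P \<or> K \<subseteq> P)"

definition prime_module :: "('r, 'z) ring_scheme \<Rightarrow> ('r, 'm, 'w) module_scheme \<Rightarrow> bool"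
  where "prime_module R M \<longleftrightarrow> prime_submodule R M {\<zero>\<^bsub>M\<^esub>}"


text \<open>Intersecting with the carrier yields the convention that \<open>X = {}\<close> has annihilator \<open>M\<close>.\<close>

definition left_annihilator ::
  "('r, 'z) ring_scheme \<Rightarrow> ('r, 'm, 'w) module_scheme \<Rightarrow> 'm set \<Rightarrow> bool"
  where "left_annihilator R M N \<longleftrightarrow>
    (\<exists>X \<subseteq> module_End R M. N = carrier M \<inter> (\<Inter>f\<in>X. a_kernel M M f))"

definition acc_left_annihilators :: "('r, 'z) ring_scheme \<Rightarrow> ('r, 'm, 'w) module_scheme \<Rightarrow> bool"
  where "acc_left_annihilators R M \<longleftrightarrow>
    (\<forall>N :: nat \<Rightarrow> 'm set. (\<forall>i. left_annihilator R M (N i)) \<and> (\<forall>i. N i \<subseteq> N (Suc i)) \<longrightarrow>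
      (\<exists>n. \<forall>k\<ge>n. N k = N n))"

definition essential_submodule ::
  "('r, 'z) ring_scheme \<Rightarrow> ('r, 'm, 'w) module_scheme \<Rightarrow> 'm set \<Rightarrow> bool"
  where "essential_submodule R M N \<longleftrightarrow> submodule N R M \<and>
    (\<forall>K. submodule K R M \<and> K \<noteq> {\<zero>\<^bsub>M\<^esub>} \<longrightarrow> N \<inter> K \<noteq> {\<zero>\<^bsub>M\<^esub>})"

definition uniform_module :: "('r, 'z) ring_scheme \<Rightarrow> ('r, 'm, 'w) module_scheme \<Rightarrow> bool"
  where "uniform_module R M \<longleftrightarrow> carrier M \<noteq> {\<zero>\<^bsub>M\<^esub>} \<and>
    (\<forall>N. submodule N R M \<and> N \<noteq> {\<zero>\<^bsub>M\<^esub>} \<longrightarrow> essential_submodule R M N)"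

definition independent_family ::
  "('r, 'z) ring_scheme \<Rightarrow> ('r, 'm, 'w) module_scheme \<Rightarrow> 'i set \<Rightarrow> ('i \<Rightarrow> 'm set) \<Rightarrow> bool"
  where "independent_family R M I U \<longleftrightarrow> (\<forall>i\<in>I. submodule (U i) R M) \<and>
    (\<forall>i\<in>I. U i \<inter> submodule_sum R M (U ` (I - {i})) = {\<zero>\<^bsub>M\<^esub>})"

text \<open>\<open>M\<close> has uniform dimension \<open>n\<close> iff it has an essential submodule that is a direct sum of
  \<open>n\<close> uniform submodules.\<close>

definition has_uniform_dim ::
  "('r, 'z) ring_scheme \<Rightarrow> ('r, 'm, 'w) module_scheme \<Rightarrow> nat \<Rightarrow> bool"
  where "has_uniform_dim R M n \<longleftrightarrow>
    (\<exists>U :: nat \<Rightarrow> 'm set. independent_family R M {..<n} U \<and>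
      (\<forall>i<n. uniform_module R (M\<lparr>carrier := U i\<rparr>)) \<and>
      essential_submodule R M (submodule_sum R M (U ` {..<n})))"

definition goldie_module :: "('r, 'z) ring_scheme \<Rightarrow> ('r, 'm, 'w) module_scheme \<Rightarrow> bool"
  where "goldie_module R M \<longleftrightarrow> acc_left_annihilators R M \<and> (\<exists>n. has_uniform_dim R M n)"

end

(*
  Suppose N is a nonzero proper fully invariant submodule. By co-semisimplicity there is a nonzero
  g : M \<rightarrow> S with S simple and M-injective and g(N) = 0. Every h : M \<rightarrow> S lifts along g to an
  endomorphism k, hence h f = g k f = 0 for each endomorphism f with f(M) \<subseteq> N. If g vanishes on
  W \<inter> Ker f, then g restricted to W factors through f(W), so that g = h f = 0 on W. Thus a
  contradiction arises as soon as finitely many such f have joint kernel 0.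
  Primeness gives joint kernel 0 for the family of all such f. To pass to a finite subfamily, note
  that an f not vanishing on a submodule W cannot have an essential kernel on W, so it is injective on
  W if W is uniform; one kills the uniform summands of an essential submodule one after the other.
*)

theory Submission
  imports Defs
begin

section \<open>Modules, submodules and homomorphisms\<close>

lemma module_hom_iff:
  "f \<in> module_hom R A B \<longleftrightarrow>
    (\<forall>x\<in>carrier A. f x \<in> carrier B) \<and>
    (\<forall>x\<in>carrier A. \<forall>y\<in>carrier A. f (x \<oplus>\<^bsub>A\<^esub> y) = f x \<oplus>\<^bsub>B\<^esub> f y) \<and>
    (\<forall>r\<in>carrier R. \<forall>x\<in>carrier A. f (r \<odot>\<^bsub>A\<^esub> x) = r \<odot>\<^bsub>B\<^esub> f x)"
  by (auto simp: module_hom_def hom_def)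

lemma module_hom_closed: "f \<in> module_hom R A B \<Longrightarrow> x \<in> carrier A \<Longrightarrow> f x \<in> carrier B"
  and module_hom_add: "f \<in> module_hom R A B \<Longrightarrow> x \<in> carrier A \<Longrightarrow> y \<in> carrier A \<Longrightarrow>
    f (x \<oplus>\<^bsub>A\<^esub> y) = f x \<oplus>\<^bsub>B\<^esub> f y"
  and module_hom_smult: "f \<in> module_hom R A B \<Longrightarrow> r \<in> carrier R \<Longrightarrow> x \<in> carrier A \<Longrightarrow>
    f (r \<odot>\<^bsub>A\<^esub> x) = r \<odot>\<^bsub>B\<^esub> f x"
  by (auto simp: module_hom_iff)

lemma module_hom_comp:
  "f \<in> module_hom R A B \<Longrightarrow> g \<in> module_hom R B C \<Longrightarrow> (\<lambda>x. g (f x)) \<in> module_hom R A C"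
  by (simp add: module_hom_iff)

lemma module_hom_restrict:
  "f \<in> module_hom R M B \<Longrightarrow> N \<subseteq> carrier M \<Longrightarrow> f \<in> module_hom R (M\<lparr>carrier := N\<rparr>) B"
  by (simp add: module_hom_iff subset_iff)

lemma module_hom_corestrict_iff:
  "N \<subseteq> carrier M \<Longrightarrow>
    f \<in> module_hom R A (M\<lparr>carrier := N\<rparr>) \<longleftrightarrow> f \<in> module_hom R A M \<and> f ` carrier A \<subseteq> N"
  by (auto simp: module_hom_iff)

lemma module_hom_funpow:
  "f \<in> module_End R M \<Longrightarrow> (f ^^ n) \<in> module_End R M"
  by (induction n) (auto simp: module_hom_iff)

context left_module
begin

lemma smult_l_null [simp]: "x \<in> carrier M \<Longrightarrow> \<zero>\<^bsub>R\<^esub> \<odot>\<^bsub>M\<^esub> x = \<zero>\<^bsub>M\<^esub>"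
  by (metis M.add.r_cancel_one' R.l_zero R.zero_closed smult_closed smult_l_distr)

lemma smult_r_null [simp]: "r \<in> carrier R \<Longrightarrow> r \<odot>\<^bsub>M\<^esub> \<zero>\<^bsub>M\<^esub> = \<zero>\<^bsub>M\<^esub>"
  by (metis M.add.r_cancel_one' M.l_zero M.zero_closed smult_closed smult_r_distr)

lemma smult_minus_one: "x \<in> carrier M \<Longrightarrow> (\<ominus>\<^bsub>R\<^esub> \<one>\<^bsub>R\<^esub>) \<odot>\<^bsub>M\<^esub> x = \<ominus>\<^bsub>M\<^esub> x"
  by (metis M.minus_equality R.add.inv_closed R.l_neg R.one_closed smult_closed smult_l_distr
      smult_l_null smult_one)

text \<open>Negatives need no separate check, since they are multiples by minus one. All later
  submodule proofs go through this criterion.\<close>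

lemma submodule_iff:
  "submodule H R M \<longleftrightarrow> H \<subseteq> carrier M \<and> \<zero>\<^bsub>M\<^esub> \<in> H \<and>
    (\<forall>x\<in>H. \<forall>y\<in>H. x \<oplus>\<^bsub>M\<^esub> y \<in> H) \<and> (\<forall>r\<in>carrier R. \<forall>x\<in>H. r \<odot>\<^bsub>M\<^esub> x \<in> H)"
  (is "?L \<longleftrightarrow> ?R")
proof
  assume ?L
  then interpret submodule H R M .
  show ?R
    using subset m_closed one_closed smult_closed by auto
next
  assume R: ?R
  have "inv\<^bsub>add_monoid M\<^esub> x \<in> H" if "x \<in> H" for x
    using R that smult_minus_one[of x] by (metis R.add.inv_closed R.one_closed a_inv_def subsetD)
  with R show ?L
    by (auto simp: submodule_def submodule_axioms_def subgroup_def)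
qed

lemma submodule_subset: "submodule H R M \<Longrightarrow> H \<subseteq> carrier M"
  and submodule_zero: "submodule H R M \<Longrightarrow> \<zero>\<^bsub>M\<^esub> \<in> H"
  and submodule_add: "submodule H R M \<Longrightarrow> x \<in> H \<Longrightarrow> y \<in> H \<Longrightarrow> x \<oplus>\<^bsub>M\<^esub> y \<in> H"
  and submodule_smult: "submodule H R M \<Longrightarrow> r \<in> carrier R \<Longrightarrow> x \<in> H \<Longrightarrow> r \<odot>\<^bsub>M\<^esub> x \<in> H"
  unfolding submodule_iff by blast+

lemma submodule_uminus: "submodule H R M \<Longrightarrow> x \<in> H \<Longrightarrow> \<ominus>\<^bsub>M\<^esub> x \<in> H"
  by (metis R.add.inv_closed R.one_closed smult_minus_one submodule_smult submodule_subset subsetD)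

lemma submodule_minus:
  "submodule H R M \<Longrightarrow> x \<in> H \<Longrightarrow> y \<in> H \<Longrightarrow> x \<ominus>\<^bsub>M\<^esub> y \<in> H"
  by (simp add: a_minus_def submodule_add submodule_uminus)

lemma submodule_carrier: "submodule (carrier M) R M"
  and submodule_null: "submodule {\<zero>\<^bsub>M\<^esub>} R M"
  and submodule_Int: "submodule H R M \<Longrightarrow> submodule K R M \<Longrightarrow> submodule (H \<inter> K) R M"
  by (auto simp: submodule_iff)

lemma left_module_submodule:
  assumes "submodule N R M"
  shows "left_module R (M\<lparr>carrier := N\<rparr>)"
proof -
  have N: "x \<in> carrier M" if "x \<in> N" for x
    using assms that by (auto simp: submodule_iff)
  have "abelian_group (M\<lparr>carrier := N\<rparr>)"
  proof (rule abelian_groupI)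
    show "\<exists>y\<in>carrier (M\<lparr>carrier := N\<rparr>). y \<oplus>\<^bsub>M\<lparr>carrier := N\<rparr>\<^esub> x = \<zero>\<^bsub>M\<lparr>carrier := N\<rparr>\<^esub>"
      if "x \<in> carrier (M\<lparr>carrier := N\<rparr>)" for x
      using that N submodule_uminus[OF assms] by (auto intro!: bexI[of _ "\<ominus>\<^bsub>M\<^esub> x"] M.l_neg)
  qed (use assms N in \<open>auto simp: submodule_zero submodule_add M.a_assoc intro: M.a_comm\<close>)
  then show ?thesis
    using assms N
    by (auto intro!: left_module.intro left_module_axioms.intro R.ring_axioms
        simp: submodule_smult smult_l_distr smult_r_distr smult_assoc1)
qed

lemma submodule_submodule_iff:
  assumes "submodule U R M"
  shows "submodule N R (M\<lparr>carrier := U\<rparr>) \<longleftrightarrow> submodule N R M \<and> N \<subseteq> U"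
  using left_module.submodule_iff[OF left_module_submodule[OF assms]] submodule_iff
    submodule_subset[OF assms] by auto

lemma smult_r_minus:
  assumes "r \<in> carrier R" "x \<in> carrier M" "y \<in> carrier M"
  shows "r \<odot>\<^bsub>M\<^esub> (x \<ominus>\<^bsub>M\<^esub> y) = r \<odot>\<^bsub>M\<^esub> x \<ominus>\<^bsub>M\<^esub> r \<odot>\<^bsub>M\<^esub> y"
proof -
  have "r \<odot>\<^bsub>M\<^esub> (\<ominus>\<^bsub>M\<^esub> y) \<oplus>\<^bsub>M\<^esub> r \<odot>\<^bsub>M\<^esub> y = \<zero>\<^bsub>M\<^esub>"
    using assms by (simp add: M.l_neg flip: smult_r_distr)
  then have "\<ominus>\<^bsub>M\<^esub> (r \<odot>\<^bsub>M\<^esub> y) = r \<odot>\<^bsub>M\<^esub> (\<ominus>\<^bsub>M\<^esub> y)"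
    using assms by (simp add: M.minus_equality)
  then show ?thesis
    using assms by (simp add: a_minus_def smult_r_distr)
qed

lemma minus_add_cancel_right:
  assumes "x \<in> carrier M" "y \<in> carrier M" "z \<in> carrier M"
  shows "(x \<oplus>\<^bsub>M\<^esub> z) \<ominus>\<^bsub>M\<^esub> (y \<oplus>\<^bsub>M\<^esub> z) = x \<ominus>\<^bsub>M\<^esub> y"
proof -
  have "(x \<oplus>\<^bsub>M\<^esub> z) \<ominus>\<^bsub>M\<^esub> (y \<oplus>\<^bsub>M\<^esub> z) = x \<oplus>\<^bsub>M\<^esub> (z \<oplus>\<^bsub>M\<^esub> (\<ominus>\<^bsub>M\<^esub> z \<oplus>\<^bsub>M\<^esub> \<ominus>\<^bsub>M\<^esub> y))"
    using assms by (simp add: a_minus_def M.minus_add M.a_assoc M.a_comm[of "\<ominus>\<^bsub>M\<^esub> y"])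
  then show ?thesis
    using assms by (simp add: a_minus_def M.r_neg2)
qed

lemma minus_zero_right: "x \<in> carrier M \<Longrightarrow> x \<ominus>\<^bsub>M\<^esub> \<zero>\<^bsub>M\<^esub> = x"
  by (metis M.l_zero M.minus_equality M.r_zero M.zero_closed a_minus_def)

lemma minus_eq_zero_iff:
  "x \<in> carrier M \<Longrightarrow> y \<in> carrier M \<Longrightarrow> x \<ominus>\<^bsub>M\<^esub> y = \<zero>\<^bsub>M\<^esub> \<longleftrightarrow> x = y"
  by (simp add: a_minus_def M.add.inv_solve_right')

end

section \<open>Transport of module structure along a map\<close>

text \<open>\<open>B\<close> is a bare record here. Every module axiom is an identity or a closure
  property, so it carries over from \<open>A\<close> once all elements of \<open>B\<close> are
  written as values of \<open>f\<close>. This yields the module axioms for concretely built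
  records.\<close>

lemma left_module_surj_image:
  assumes "left_module R A" and surj: "f ` carrier A = carrier B" and zero: "\<zero>\<^bsub>B\<^esub> = f \<zero>\<^bsub>A\<^esub>"
    and add: "\<And>x y. x \<in> carrier A \<Longrightarrow> y \<in> carrier A \<Longrightarrow> f x \<oplus>\<^bsub>B\<^esub> f y = f (x \<oplus>\<^bsub>A\<^esub> y)"
    and smult: "\<And>r x. r \<in> carrier R \<Longrightarrow> x \<in> carrier A \<Longrightarrow> r \<odot>\<^bsub>B\<^esub> f x = f (r \<odot>\<^bsub>A\<^esub> x)"
  shows "left_module R B"
proof -
  interpret A: left_module R A by fact
  have closed: "x \<in> carrier A \<Longrightarrow> f x \<in> carrier B" for x
    using surj by auto
  have "abelian_group B"
  proof (rule abelian_groupI)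
    fix x y z assume xyz: "x \<in> carrier B" "y \<in> carrier B" "z \<in> carrier B"
    obtain x' y' z' where eq: "x = f x'" "y = f y'" "z = f z'"
      and "x' \<in> carrier A" "y' \<in> carrier A" "z' \<in> carrier A"
      using xyz unfolding surj[symmetric] by blast
    then show "x \<oplus>\<^bsub>B\<^esub> y \<oplus>\<^bsub>B\<^esub> z = x \<oplus>\<^bsub>B\<^esub> (y \<oplus>\<^bsub>B\<^esub> z)"
      by (simp add: add A.M.a_assoc)
  next
    fix x y assume xyz: "x \<in> carrier B" "y \<in> carrier B"
    obtain x' y' where eq: "x = f x'" "y = f y'" and "x' \<in> carrier A" "y' \<in> carrier A"
      using xyz unfolding surj[symmetric] by blast
    then show "x \<oplus>\<^bsub>B\<^esub> y = y \<oplus>\<^bsub>B\<^esub> x" "x \<oplus>\<^bsub>B\<^esub> y \<in> carrier B"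
      by (simp_all add: add closed A.M.a_comm)
  next
    fix x assume xyz: "x \<in> carrier B"
    obtain x' where eq: "x = f x'" and x': "x' \<in> carrier A"
      using xyz unfolding surj[symmetric] by blast
    then show "\<zero>\<^bsub>B\<^esub> \<oplus>\<^bsub>B\<^esub> x = x"
      by (simp add: add zero)
    have "f (\<ominus>\<^bsub>A\<^esub> x') \<oplus>\<^bsub>B\<^esub> x = \<zero>\<^bsub>B\<^esub>"
      using eq x' by (simp add: add zero A.M.l_neg)
    then show "\<exists>y\<in>carrier B. y \<oplus>\<^bsub>B\<^esub> x = \<zero>\<^bsub>B\<^esub>"
      using closed x' by blast
  qed (simp add: zero closed)
  moreover have "left_module_axioms R B"
    unfolding left_module_axioms_def surj[symmetric]
    by (intro conjI allI impI; elim imageE;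
        simp add: smult add A.smult_l_distr A.smult_r_distr A.smult_assoc1)
  ultimately show ?thesis
    by (intro left_module.intro A.R.ring_axioms)
qed

text \<open>The operations are computed on chosen representatives, so they make sense when the
  fibres of \<open>f\<close> form a congruence. An injective \<open>f\<close> gives an isomorphic
  copy in another type; an \<open>f\<close> whose fibres are the cosets of a submodule gives a
  quotient.\<close>

definition image_module ::
  "('a \<Rightarrow> 'b) \<Rightarrow> ('r, 'a, 'w) module_scheme \<Rightarrow> ('r, 'b) module"
  where "image_module f A =
    \<lparr>carrier = f ` carrier A, mult = undefined, one = undefined, zero = f \<zero>\<^bsub>A\<^esub>,
     add = (\<lambda>x y. f (inv_into (carrier A) f x \<oplus>\<^bsub>A\<^esub> inv_into (carrier A) f y)),
     smult = (\<lambda>r x. f (r \<odot>\<^bsub>A\<^esub> inv_into (carrier A) f x))\<rparr>"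

lemma image_module:
  assumes "left_module R A"
    and add: "\<And>x y z. x \<in> carrier A \<Longrightarrow> y \<in> carrier A \<Longrightarrow> z \<in> carrier A \<Longrightarrow> f x = f y \<Longrightarrow>
      f (x \<oplus>\<^bsub>A\<^esub> z) = f (y \<oplus>\<^bsub>A\<^esub> z)"
    and smult: "\<And>r x y. r \<in> carrier R \<Longrightarrow> x \<in> carrier A \<Longrightarrow> y \<in> carrier A \<Longrightarrow> f x = f y \<Longrightarrow>
      f (r \<odot>\<^bsub>A\<^esub> x) = f (r \<odot>\<^bsub>A\<^esub> y)"
  shows "left_module R (image_module f A)" and "f \<in> module_hom R A (image_module f A)"
proof -
  interpret A: left_module R A by fact
  let ?s = "inv_into (carrier A) f"
  have s: "?s (f x) \<in> carrier A" "f (?s (f x)) = f x" if "x \<in> carrier A" for x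
    using that by (auto intro: inv_into_into f_inv_into_f)
  \<comment> \<open>The congruence hypothesis changes the left summand. It is applied twice, with
    commutativity in between, to replace both representatives.\<close>
  have *: "f (?s (f x) \<oplus>\<^bsub>A\<^esub> ?s (f y)) = f (x \<oplus>\<^bsub>A\<^esub> y)" if "x \<in> carrier A" "y \<in> carrier A" for x y
    using add[of "?s (f x)" x "?s (f y)"] add[of "?s (f y)" y x] s that
    by (simp add: A.M.a_comm)
  have **: "f (r \<odot>\<^bsub>A\<^esub> ?s (f x)) = f (r \<odot>\<^bsub>A\<^esub> x)" if "r \<in> carrier R" "x \<in> carrier A" for r x
    using smult[of r "?s (f x)" x] s that by simp
  show "left_module R (image_module f A)"
    by (rule left_module_surj_image[OF assms(1), of f]) (auto simp: image_module_def * **)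
  show "f \<in> module_hom R A (image_module f A)"
    by (auto simp: module_hom_iff image_module_def * **)
qed

lemma carrier_image_module [simp]: "carrier (image_module f A) = f ` carrier A"
  and zero_image_module [simp]: "\<zero>\<^bsub>image_module f A\<^esub> = f \<zero>\<^bsub>A\<^esub>"
  by (simp_all add: image_module_def)

lemma module_hom_zero:
  assumes "left_module R A" "left_module R B" "f \<in> module_hom R A B"
  shows "f \<zero>\<^bsub>A\<^esub> = \<zero>\<^bsub>B\<^esub>"
proof -
  interpret A: left_module R A by fact
  interpret B: left_module R B by fact
  show ?thesis
    using module_hom_smult[OF assms(3), of "\<zero>\<^bsub>R\<^esub>" "\<zero>\<^bsub>A\<^esub>"] module_hom_closed[OF assms(3)]
    by simp
qed

lemma (in left_module) module_hom_minus_on: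
  assumes "submodule N R M" "left_module R B" "f \<in> module_hom R (M\<lparr>carrier := N\<rparr>) B"
    and "x \<in> N" "y \<in> N"
  shows "f (x \<ominus>\<^bsub>M\<^esub> y) = f x \<ominus>\<^bsub>B\<^esub> f y"
proof -
  interpret B: left_module R B by fact
  have "y \<in> carrier M"
    using assms submodule_subset by auto
  then have "f (\<ominus>\<^bsub>M\<^esub> y) = \<ominus>\<^bsub>B\<^esub> f y"
    using module_hom_smult[OF assms(3), of "\<ominus>\<^bsub>R\<^esub> \<one>\<^bsub>R\<^esub>" y] module_hom_closed[OF assms(3)] assms(5)
    by (simp add: smult_minus_one B.smult_minus_one)
  then show ?thesis
    using module_hom_add[OF assms(3), of x "\<ominus>\<^bsub>M\<^esub> y"] submodule_uminus assms
    by (simp add: a_minus_def)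
qed

lemma (in left_module) module_hom_minus:
  assumes "left_module R B" "f \<in> module_hom R M B" "x \<in> carrier M" "y \<in> carrier M"
  shows "f (x \<ominus>\<^bsub>M\<^esub> y) = f x \<ominus>\<^bsub>B\<^esub> f y"
  by (rule module_hom_minus_on[OF submodule_carrier assms(1) _ assms(3,4)]) (simp add: assms(2))

section \<open>Preimages, kernels and images of submodules\<close>

lemma submodule_vimage:
  assumes "left_module R A" "left_module R B" "f \<in> module_hom R A B"
    "submodule N R A" "submodule H R B"
  shows "submodule {x \<in> N. f x \<in> H} R A"
proof -
  interpret A: left_module R A by fact
  interpret B: left_module R B by fact
  show ?thesis
    using assms(3-5) module_hom_zero[OF assms(1-3)]
    by (auto simp: A.submodule_iff B.submodule_iff module_hom_iff subset_iff)
qed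

lemma submodule_kernel_on:
  assumes "left_module R A" "left_module R B" "f \<in> module_hom R A B" "submodule N R A"
  shows "submodule {x \<in> N. f x = \<zero>\<^bsub>B\<^esub>} R A"
  using submodule_vimage[OF assms left_module.submodule_null[OF assms(2)]] by simp

lemma submodule_image:
  assumes "left_module R A" "left_module R B" "f \<in> module_hom R A B" "submodule N R A"
  shows "submodule (f ` N) R B"
proof -
  interpret A: left_module R A by fact
  interpret B: left_module R B by fact
  have N: "x \<in> carrier A" if "x \<in> N" for x
    using that assms(4) by (auto simp: A.submodule_iff)
  have "\<exists>z\<in>N. f x \<oplus>\<^bsub>B\<^esub> f y = f z" if "x \<in> N" "y \<in> N" for x y
    using that N assms(3,4) by (intro bexI[of _ "x \<oplus>\<^bsub>A\<^esub> y"]) (auto simp: A.submodule_iff module_hom_iff)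
  moreover have "\<exists>z\<in>N. r \<odot>\<^bsub>B\<^esub> f x = f z" if "x \<in> N" "r \<in> carrier R" for x r
    using that N assms(3,4) by (intro bexI[of _ "r \<odot>\<^bsub>A\<^esub> x"]) (auto simp: A.submodule_iff module_hom_iff)
  ultimately show ?thesis
    using N assms(3,4) module_hom_zero[OF assms(1-3)]
    by (auto simp: B.submodule_iff module_hom_closed image_iff intro: A.submodule_zero dest: sym)
qed

section \<open>Subfactors of \<open>M\<close> and projectivity\<close>

text \<open>A direct sum with one index is the image of \<open>M\<close> under the map sending an
  element to the corresponding constant family.\<close>

lemma (in left_module) left_module_direct_power_singleton:
  "left_module R (direct_power M {i})"
proof -
  let ?c = "\<lambda>w. \<lambda>j\<in>{i}. w"
  have "x \<in> ?c ` carrier M" if "x \<in> {i} \<rightarrow>\<^sub>E carrier M" for x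
    using that by (intro image_eqI[of _ _ "x i"]) (auto simp: fun_eq_iff PiE_def extensional_def)
  then have *: "carrier (direct_power M {i}) = ?c ` carrier M"
    by (auto simp: direct_power_def split: if_splits)
  show "left_module R (direct_power M {i})"
    by (rule left_module_surj_image[OF left_module_axioms, of ?c])
      (simp add: *, auto simp: direct_power_def fun_eq_iff)
qed

text \<open>By surjectivity \<open>A\<close> is isomorphic to \<open>W\<close> modulo the kernel of
  \<open>f\<close>, and this embeds into \<open>M\<close> modulo the same kernel. Hence a single
  copy of \<open>M\<close> suffices, with an arbitrary index \<open>i\<close>.\<close>

lemma (in left_module) in_sigma_subfactor:
  assumes A: "left_module R A" and W: "submodule W R M"
    and f: "f \<in> module_hom R (M\<lparr>carrier := W\<rparr>) A" and surj: "f ` W = carrier A"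
  shows "in_sigma R M (A :: ('r, 'a, 'v) module_scheme)"
proof -
  define i :: "'a \<times> nat" where "i = undefined"
  define D where "D = direct_power M {i}"
  define c where "c = (\<lambda>w. \<lambda>j\<in>{i}. w :: 'm)"
  define K where "K = c ` {w \<in> W. f w = \<zero>\<^bsub>A\<^esub>}"
  \<comment> \<open>The embedding sends \<open>a\<close> to its full preimage under
    \<open>f\<close>, viewed in the one-index direct sum through \<open>c\<close>. This set is a
    coset of \<open>K\<close>, so no representative has to be chosen.\<close>
  define e where "e = (\<lambda>a. c ` {w \<in> W. f w = a})"
  interpret A: left_module R A by fact
  interpret D: left_module R D
    unfolding D_def by (rule left_module_direct_power_singleton)
  have LW: "left_module R (M\<lparr>carrier := W\<rparr>)"
    by (rule left_module_submodule[OF W])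
  have Wc: "w \<in> carrier M" if "w \<in> W" for w
    using that submodule_subset[OF W] by auto
  have c_inj: "c x = c y \<longleftrightarrow> x = y" for x y
    unfolding c_def by (metis restrict_apply' singletonI)
  have c_hom: "c \<in> module_hom R M D"
    by (auto simp: module_hom_iff D_def direct_power_def c_def fun_eq_iff)
  have c_add: "c x \<oplus>\<^bsub>D\<^esub> c y = c (x \<oplus>\<^bsub>M\<^esub> y)" if "x \<in> carrier M" "y \<in> carrier M" for x y
    using module_hom_add[OF c_hom that] by simp
  have c_smult: "r \<odot>\<^bsub>D\<^esub> c x = c (r \<odot>\<^bsub>M\<^esub> x)" if "r \<in> carrier R" "x \<in> carrier M" for r x
    using module_hom_smult[OF c_hom that] by simp
  have f_add: "f (x \<oplus>\<^bsub>M\<^esub> y) = f x \<oplus>\<^bsub>A\<^esub> f y" if "x \<in> W" "y \<in> W" for x y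
    using module_hom_add[OF f] that by simp
  have f_smult: "f (r \<odot>\<^bsub>M\<^esub> x) = r \<odot>\<^bsub>A\<^esub> f x" if "r \<in> carrier R" "x \<in> W" for r x
    using module_hom_smult[OF f] that by simp
  have f_closed: "f x \<in> carrier A" if "x \<in> W" for x
    using module_hom_closed[OF f] that by simp
  have "submodule {w \<in> W. f w = \<zero>\<^bsub>A\<^esub>} R M"
    using submodule_kernel_on[OF LW A f left_module.submodule_carrier[OF LW]]
    by (simp add: submodule_submodule_iff[OF W])
  then have K: "submodule K R D"
    unfolding K_def by (rule submodule_image[OF left_module_axioms D.left_module_axioms c_hom])
  interpret K: abelian_subgroup K D
    using K by (intro abelian_subgroupI3 additive_subgroup.intro D.abelian_group_axioms)
      (auto simp: submodule_def)
  \<comment> \<open>Two elements of \<open>W\<close> have the same value under \<open>f\<close> iff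
    they differ by an element of the kernel; hence fibres are cosets. Compatibility of
    \<open>e\<close> with the operations reduces to this identity.\<close>
  have coset: "K +>\<^bsub>D\<^esub> c w = e (f w)" if w: "w \<in> W" for w
  proof -
    have "c v \<in> K +>\<^bsub>D\<^esub> c w" if v: "v \<in> W" "f v = f w" for v
    proof -
      have "f (v \<ominus>\<^bsub>M\<^esub> w) = \<zero>\<^bsub>A\<^esub>"
        using module_hom_minus_on[OF W A f] v w f_closed by (simp add: A.minus_eq_zero_iff)
      then have "c (v \<ominus>\<^bsub>M\<^esub> w) \<in> K"
        using submodule_minus[OF W] v w by (auto simp: K_def)
      moreover have "c v = c (v \<ominus>\<^bsub>M\<^esub> w) \<oplus>\<^bsub>D\<^esub> c w"
        using v w Wc by (simp add: c_add a_minus_def M.a_assoc M.l_neg)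
      ultimately show ?thesis
        unfolding a_r_coset_def' by blast
    qed
    moreover have "x \<in> e (f w)" if x: "x \<in> K +>\<^bsub>D\<^esub> c w" for x
    proof -
      obtain v where v: "v \<in> W" "f v = \<zero>\<^bsub>A\<^esub>" "x = c v \<oplus>\<^bsub>D\<^esub> c w"
        using x unfolding a_r_coset_def' K_def by auto
      then have "x = c (v \<oplus>\<^bsub>M\<^esub> w)" "f (v \<oplus>\<^bsub>M\<^esub> w) = f w"
        using w by (simp_all add: c_add Wc f_add f_closed)
      then show ?thesis
        using submodule_add[OF W v(1) w] by (auto simp: e_def)
    qed
    ultimately show ?thesis
      by (auto simp: e_def)
  qed
  have c_closed: "c w \<in> carrier D" if "w \<in> W" for w
    using module_hom_closed[OF c_hom] Wc that by blast
  have "e \<in> module_hom R A (quotient_module D K)"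
    unfolding module_hom_iff
  proof (intro conjI ballI)
    fix x assume "x \<in> carrier A"
    then obtain v where v: "v \<in> W" "x = f v"
      using surj by auto
    show "e x \<in> carrier (quotient_module D K)"
      using D.a_rcosetsI[OF K.a_subset c_closed[OF v(1)]] v(2) coset[OF v(1)]
      by (simp add: quotient_module_def)
    fix y assume "y \<in> carrier A"
    then obtain w where w: "w \<in> W" "y = f w"
      using surj by auto
    show "e (x \<oplus>\<^bsub>A\<^esub> y) = e x \<oplus>\<^bsub>quotient_module D K\<^esub> e y"
      using K.a_rcos_sum[OF c_closed[OF v(1)] c_closed[OF w(1)]] v w coset submodule_add[OF W]
      by (simp add: quotient_module_def c_add Wc f_add)
  next
    fix r x assume r: "r \<in> carrier R" and "x \<in> carrier A"
    then obtain v where v: "v \<in> W" "x = f v"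
      using surj by auto
    \<comment> \<open>Scalar multiplication in the quotient is a union over all members of a coset.
      All terms of the union agree, and the coset is nonempty, so the union is their common
      value.\<close>
    have "K +>\<^bsub>D\<^esub> (r \<odot>\<^bsub>D\<^esub> u) = e (r \<odot>\<^bsub>A\<^esub> x)" if "u \<in> e x" for u
      using that r coset submodule_smult[OF W r] by (auto simp: e_def c_smult Wc f_smult)
    moreover have "e x \<noteq> {}"
      using v by (auto simp: e_def)
    ultimately show "e (r \<odot>\<^bsub>A\<^esub> x) = r \<odot>\<^bsub>quotient_module D K\<^esub> e x"
      by (simp add: quotient_module_def)
  qed
  moreover have "inj_on e (carrier A)"
  proof (rule inj_onI)
    fix x y assume "x \<in> carrier A" and eq: "e x = e y"
    then obtain v where v: "v \<in> W" "x = f v"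
      using surj by auto
    then have "c v \<in> e y"
      using eq by (auto simp: e_def)
    then show "x = y"
      using v by (auto simp: e_def c_inj)
  qed
  ultimately show ?thesis
    unfolding in_sigma_def using A K unfolding D_def by blast
qed

section \<open>Coding in the universe type and lifting along epimorphisms\<close>

text \<open>Coding subsets rather than elements serves two purposes: elements of \<open>M\<close>
  are coded by singletons, and cosets can be coded as they are.\<close>

definition to_univ :: "'m set \<Rightarrow> ('r, 'm) sigma_univ"
  where "to_univ X = {0} \<times> {undefined} \<times> X"

lemma inj_to_univ: "inj to_univ"
  by (auto simp: inj_def to_univ_def)

text \<open>The sequence from the kernel of \<open>p\<close> to \<open>U\<close> to \<open>S\<close>
  is exact, and all three modules are subfactors of \<open>M\<close>. Projectivity speaks about
  modules over the universe type, so the kernel and \<open>U\<close> are first copied there; the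
  lift is then decoded to an endomorphism with values in \<open>U\<close>.\<close>

lemma (in left_module) projective_lift:
  fixes S :: "('r, ('r, 'm) sigma_univ) module"
  assumes proj: "projective_in_sigma R M" and S: "left_module R S" and U: "submodule U R M"
    and p: "p \<in> module_hom R (M\<lparr>carrier := U\<rparr>) S" and surj: "p ` U = carrier S"
    and h: "h \<in> module_hom R M S"
  shows "\<exists>k\<in>module_End R M. k ` carrier M \<subseteq> U \<and> (\<forall>x\<in>carrier M. p (k x) = h x)"
proof -
  define \<iota> :: "'m \<Rightarrow> ('r, 'm) sigma_univ" where "\<iota> = (\<lambda>m. to_univ {m})"
  define V where "V = {u \<in> U. p u = \<zero>\<^bsub>S\<^esub>}"
  define A where "A = image_module \<iota> (M\<lparr>carrier := V\<rparr>)"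
  define B where "B = image_module \<iota> (M\<lparr>carrier := U\<rparr>)"
  have inj: "inj \<iota>"
    using inj_to_univ by (auto simp: \<iota>_def inj_def)
  have [simp]: "inv_into UNIV \<iota> (\<iota> x) = x" for x
    using inj by simp
  have LU: "left_module R (M\<lparr>carrier := U\<rparr>)"
    by (rule left_module_submodule[OF U])
  have V: "submodule V R M"
    using submodule_kernel_on[OF LU S p left_module.submodule_carrier[OF LU]]
    by (simp add: submodule_submodule_iff[OF U] V_def)
  have VU: "V \<subseteq> U"
    by (auto simp: V_def)
  have im: "left_module R (image_module \<iota> (M\<lparr>carrier := W\<rparr>))"
    "\<iota> \<in> module_hom R (M\<lparr>carrier := W\<rparr>) (image_module \<iota> (M\<lparr>carrier := W\<rparr>))"
    if "submodule W R M" for W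
    using image_module[OF left_module_submodule[OF that], of \<iota>] inj by (auto dest: injD)
  have "in_sigma R M A" "in_sigma R M B"
    unfolding A_def B_def
    by (rule in_sigma_subfactor[OF im(1)[OF V] V im(2)[OF V]], simp)
      (rule in_sigma_subfactor[OF im(1)[OF U] U im(2)[OF U]], simp)
  moreover have "in_sigma R M S"
    by (rule in_sigma_subfactor[OF S U p surj])
  moreover have invB: "inv_into UNIV \<iota> \<in> module_hom R B (M\<lparr>carrier := U\<rparr>)"
    using module_hom_add[OF im(2)[OF U], symmetric] module_hom_smult[OF im(2)[OF U], symmetric]
    by (simp add: module_hom_iff B_def)
  \<comment> \<open>The copies \<open>A\<close> and \<open>B\<close> use the same coding
    \<open>\<iota>\<close>, so the inclusion of the kernel becomes the identity map;
    \<open>p\<close> is applied after decoding.\<close>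
  moreover have "short_exact R A B S (\<lambda>x. x) (\<lambda>x. p (inv_into UNIV \<iota> x))"
    unfolding short_exact_def
  proof (intro conjI)
    show "(\<lambda>x. x) \<in> module_hom R A B"
      using module_hom_add[OF im(2)[OF U], symmetric] module_hom_smult[OF im(2)[OF U], symmetric]
        module_hom_add[OF im(2)[OF V], symmetric] module_hom_smult[OF im(2)[OF V], symmetric] VU
      by (simp add: module_hom_iff A_def B_def subset_iff)
    show "(\<lambda>x. p (inv_into UNIV \<iota> x)) \<in> module_hom R B S"
      by (rule module_hom_comp[OF invB p])
    show "(\<lambda>x. x) ` carrier A = a_kernel B S (\<lambda>x. p (inv_into UNIV \<iota> x))"
    proof (intro subset_antisym subsetI)
      fix y assume "y \<in> (\<lambda>x. x) ` carrier A"
      then obtain u where "u \<in> U" "p u = \<zero>\<^bsub>S\<^esub>" "y = \<iota> u"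
        unfolding A_def V_def by auto
      then show "y \<in> a_kernel B S (\<lambda>x. p (inv_into UNIV \<iota> x))"
        by (simp add: a_kernel_def' B_def)
    next
      fix y assume "y \<in> a_kernel B S (\<lambda>x. p (inv_into UNIV \<iota> x))"
      then have y: "y \<in> \<iota> ` U" "p (inv_into UNIV \<iota> y) = \<zero>\<^bsub>S\<^esub>"
        by (simp_all add: a_kernel_def' B_def)
      then obtain u where "u \<in> U" "y = \<iota> u"
        by blast
      then show "y \<in> (\<lambda>x. x) ` carrier A"
        using y(2) by (simp add: A_def V_def)
    qed
    show "(\<lambda>x. p (inv_into UNIV \<iota> x)) ` carrier B = carrier S"
      using surj by (simp add: B_def image_image)
  qed simp
  ultimately have "Hom_short_exact R M A B S (\<lambda>x. x) (\<lambda>x. p (inv_into UNIV \<iota> x))"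
    using proj unfolding projective_in_sigma_def by blast
  then have "\<forall>f\<in>module_hom R M S. \<exists>g\<in>module_hom R M B. \<forall>x\<in>carrier M. f x = p (inv_into UNIV \<iota> (g x))"
    unfolding Hom_short_exact_def by (elim conjE)
  from bspec[OF this h] obtain g
    where g: "g \<in> module_hom R M B" "\<forall>x\<in>carrier M. h x = p (inv_into UNIV \<iota> (g x))"
    by (elim bexE)
  have "(\<lambda>x. inv_into UNIV \<iota> (g x)) \<in> module_hom R M (M\<lparr>carrier := U\<rparr>)"
    by (rule module_hom_comp[OF g(1) invB])
  then show ?thesis
    using g(2) unfolding module_hom_corestrict_iff[OF submodule_subset[OF U]]
    by (intro bexI[of _ "\<lambda>x. inv_into UNIV \<iota> (g x)"]) simp_all
qed

section \<open>Consequences of co-semisimplicity and projectivity\<close>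

context left_module
begin

lemma submodule_set_add:
  assumes "submodule A R M" "submodule B R M"
  shows "submodule (A <+>\<^bsub>M\<^esub> B) R M"
proof -
  have A: "a \<in> carrier M" if "a \<in> A" for a
    using that assms(1) by (auto simp: submodule_iff)
  have B: "b \<in> carrier M" if "b \<in> B" for b
    using that assms(2) by (auto simp: submodule_iff)
  have "\<exists>a''\<in>A. \<exists>b''\<in>B. a \<oplus>\<^bsub>M\<^esub> b \<oplus>\<^bsub>M\<^esub> (a' \<oplus>\<^bsub>M\<^esub> b') = a'' \<oplus>\<^bsub>M\<^esub> b''"
    if "a \<in> A" "b \<in> B" "a' \<in> A" "b' \<in> B" for a b a' b'
    using that A B assms
    by (intro bexI[of _ "a \<oplus>\<^bsub>M\<^esub> a'"] bexI[of _ "b \<oplus>\<^bsub>M\<^esub> b'"])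
      (auto simp: submodule_add M.a_ac)
  moreover have "\<exists>a'\<in>A. \<exists>b'\<in>B. r \<odot>\<^bsub>M\<^esub> (a \<oplus>\<^bsub>M\<^esub> b) = a' \<oplus>\<^bsub>M\<^esub> b'"
    if "a \<in> A" "b \<in> B" "r \<in> carrier R" for a b r
    using that A B assms
    by (intro bexI[of _ "r \<odot>\<^bsub>M\<^esub> a"] bexI[of _ "r \<odot>\<^bsub>M\<^esub> b"])
      (auto simp: submodule_smult smult_r_distr)
  moreover have "\<exists>a\<in>A. \<exists>b\<in>B. \<zero>\<^bsub>M\<^esub> = a \<oplus>\<^bsub>M\<^esub> b"
    using submodule_zero assms by (intro bexI[of _ "\<zero>\<^bsub>M\<^esub>"]) auto
  ultimately show ?thesis
    using A B by (auto simp: submodule_iff set_add_def')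
qed

lemma subset_set_add:
  assumes "submodule A R M" "submodule B R M"
  shows "A \<subseteq> A <+>\<^bsub>M\<^esub> B" "B \<subseteq> A <+>\<^bsub>M\<^esub> B"
proof -
  have "\<exists>a'\<in>A. \<exists>b\<in>B. a = a' \<oplus>\<^bsub>M\<^esub> b" if "a \<in> A" for a
    using that assms submodule_zero[OF assms(2)] submodule_subset[OF assms(1)]
    by (intro bexI[of _ a] bexI[of _ "\<zero>\<^bsub>M\<^esub>"]) auto
  then show "A \<subseteq> A <+>\<^bsub>M\<^esub> B"
    by (auto simp: set_add_def')
  have "\<exists>a\<in>A. \<exists>b'\<in>B. b = a \<oplus>\<^bsub>M\<^esub> b'" if "b \<in> B" for b
    using that assms submodule_zero[OF assms(1)] submodule_subset[OF assms(2)]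
    by (intro bexI[of _ b] bexI[of _ "\<zero>\<^bsub>M\<^esub>"]) auto
  then show "B \<subseteq> A <+>\<^bsub>M\<^esub> B"
    by (auto simp: set_add_def')
qed

lemma submodule_cyclic:
  assumes x: "x \<in> carrier M"
  shows "submodule ((\<lambda>r. r \<odot>\<^bsub>M\<^esub> x) ` carrier R) R M"
proof -
  have "\<exists>t\<in>carrier R. r \<odot>\<^bsub>M\<^esub> x \<oplus>\<^bsub>M\<^esub> s \<odot>\<^bsub>M\<^esub> x = t \<odot>\<^bsub>M\<^esub> x"
    if "r \<in> carrier R" "s \<in> carrier R" for r s
    using that x by (intro bexI[of _ "r \<oplus>\<^bsub>R\<^esub> s"]) (auto simp: smult_l_distr)
  moreover have "\<exists>t\<in>carrier R. r \<odot>\<^bsub>M\<^esub> (s \<odot>\<^bsub>M\<^esub> x) = t \<odot>\<^bsub>M\<^esub> x"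
    if "r \<in> carrier R" "s \<in> carrier R" for r s
    using that x by (intro bexI[of _ "r \<otimes>\<^bsub>R\<^esub> s"]) (auto simp: smult_assoc1)
  moreover have "\<exists>t\<in>carrier R. \<zero>\<^bsub>M\<^esub> = t \<odot>\<^bsub>M\<^esub> x"
    using x by (intro bexI[of _ "\<zero>\<^bsub>R\<^esub>"]) auto
  ultimately show ?thesis
    using x by (auto simp: submodule_iff image_iff)
qed

lemma submodule_joint_kernel:
  assumes B: "left_module R B" and F: "F \<subseteq> module_hom R M B"
  shows "submodule {x \<in> carrier M. \<forall>f\<in>F. f x = \<zero>\<^bsub>B\<^esub>} R M"
proof -
  interpret B: left_module R B by fact
  have "f \<zero>\<^bsub>M\<^esub> = \<zero>\<^bsub>B\<^esub>" if "f \<in> F" for f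
    using module_hom_zero[OF left_module_axioms B] F that by blast
  moreover have "f (x \<oplus>\<^bsub>M\<^esub> y) = \<zero>\<^bsub>B\<^esub>"
    if "f \<in> F" "x \<in> carrier M" "y \<in> carrier M" "f x = \<zero>\<^bsub>B\<^esub>" "f y = \<zero>\<^bsub>B\<^esub>" for f x y
    using module_hom_add[of f R M B x y] F that by auto
  moreover have "f (r \<odot>\<^bsub>M\<^esub> x) = \<zero>\<^bsub>B\<^esub>"
    if "f \<in> F" "r \<in> carrier R" "x \<in> carrier M" "f x = \<zero>\<^bsub>B\<^esub>" for f r x
    using module_hom_smult[of f R M B r x] F that by auto
  ultimately show ?thesis
    by (simp add: submodule_iff)
qed

section \<open>Simple M-injective images of M\<close>

text \<open>Zorn's lemma: the union of a nonempty chain is closed under addition because any two of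
  its elements lie in a common member.\<close>

lemma submodule_maximal_avoiding:
  assumes K: "submodule K R M" and x: "x \<notin> K"
  shows "\<exists>L. submodule L R M \<and> K \<subseteq> L \<and> x \<notin> L \<and>
    (\<forall>H. submodule H R M \<and> L \<subseteq> H \<and> x \<notin> H \<longrightarrow> H = L)"
proof -
  define \<A> where "\<A> = {L. submodule L R M \<and> K \<subseteq> L \<and> x \<notin> L}"
  have "\<exists>L\<in>\<A>. \<forall>X\<in>\<A>. L \<subseteq> X \<longrightarrow> X = L"
  proof (rule subset_Zorn_nonempty)
    show "\<A> \<noteq> {}"
      using K x by (auto simp: \<A>_def)
    fix \<C> assume ne: "\<C> \<noteq> {}" and chain: "subset.chain \<A> \<C>"
    then have sub: "L \<in> \<C> \<Longrightarrow> submodule L R M \<and> K \<subseteq> L \<and> x \<notin> L" for L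
      unfolding subset_chain_def \<A>_def by blast
    have "y \<oplus>\<^bsub>M\<^esub> z \<in> \<Union>\<C>" if yz: "y \<in> \<Union>\<C>" "z \<in> \<Union>\<C>" for y z
    proof -
      obtain P Q where PQ: "P \<in> \<C>" "y \<in> P" "Q \<in> \<C>" "z \<in> Q"
        using yz by blast
      have "P \<subseteq> Q \<or> Q \<subseteq> P"
        using chain PQ(1,3) by (simp add: subset_chain_def)
      then obtain L where L: "L \<in> \<C>" "y \<in> L" "z \<in> L"
        using PQ by blast
      then show ?thesis
        using submodule_add[of L y z] sub[OF L(1)] by blast
    qed
    moreover have "\<Union>\<C> \<subseteq> carrier M"
      using sub submodule_subset by (simp add: Union_least)
    moreover have "\<zero>\<^bsub>M\<^esub> \<in> \<Union>\<C>"
      using sub submodule_zero ne by (meson UnionI ex_in_conv)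
    moreover have "r \<odot>\<^bsub>M\<^esub> y \<in> \<Union>\<C>" if ry: "r \<in> carrier R" "y \<in> \<Union>\<C>" for r y
    proof -
      obtain L where L: "L \<in> \<C>" "y \<in> L"
        using ry(2) by blast
      then show ?thesis
        using submodule_smult[of L r y] sub[OF L(1)] ry(1) by blast
    qed
    ultimately have "submodule (\<Union>\<C>) R M"
      by (simp add: submodule_iff)
    then show "\<Union>\<C> \<in> \<A>"
      using sub ne by (auto simp: \<A>_def)
  qed
  then obtain L where L: "L \<in> \<A>" "\<forall>X\<in>\<A>. L \<subseteq> X \<longrightarrow> X = L"
    by blast
  have sub: "submodule L R M" "K \<subseteq> L" "x \<notin> L"
    using L(1) by (simp_all add: \<A>_def)
  show ?thesis
  proof (intro exI[of _ L] conjI allI impI)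
    fix H assume H: "submodule H R M \<and> L \<subseteq> H \<and> x \<notin> H"
    then have "H \<in> \<A>"
      using sub(2) by (simp add: \<A>_def subset_trans[of K L H])
    then show "H = L"
      using L(2) H by simp
  qed (fact sub)+
qed

text \<open>Let \<open>L\<close> be maximal among the submodules that contain \<open>K\<close> and
  avoid \<open>x\<close>, and let \<open>W\<close> be the sum of \<open>L\<close> and the cyclic
  submodule of \<open>x\<close>. Then \<open>W\<close> modulo \<open>L\<close> is simple and a
  subfactor of \<open>M\<close>, so it is \<open>M\<close>-injective, and the projection from
  \<open>W\<close> extends to \<open>M\<close>.\<close>

lemma cosemisimple_separates:
  assumes cs: "cosemisimple R M" and K: "submodule K R M" and x: "x \<in> carrier M" "x \<notin> K"
  obtains S :: "('r, ('r, 'm) sigma_univ) module" and g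
  where "simple_module R S" "rel_injective R M S" "g \<in> module_hom R M S"
    "g x \<noteq> \<zero>\<^bsub>S\<^esub>" "\<And>y. y \<in> K \<Longrightarrow> g y = \<zero>\<^bsub>S\<^esub>"
proof -
  obtain L where L: "submodule L R M" "K \<subseteq> L" "x \<notin> L"
    and Lmax: "\<And>H. submodule H R M \<Longrightarrow> L \<subseteq> H \<Longrightarrow> x \<notin> H \<Longrightarrow> H = L"
    using submodule_maximal_avoiding[OF K x(2)] by metis
  define C where "C = (\<lambda>r. r \<odot>\<^bsub>M\<^esub> x) ` carrier R"
  define W where "W = C <+>\<^bsub>M\<^esub> L"
  \<comment> \<open>The projection onto cosets of \<open>L\<close>, coded in the universe type; thus
    \<open>S\<close> is a copy of \<open>W\<close> modulo \<open>L\<close>.\<close>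
  define q :: "'m \<Rightarrow> ('r, 'm) sigma_univ" where "q = (\<lambda>w. to_univ (L +>\<^bsub>M\<^esub> w))"
  define S where "S = image_module q (M\<lparr>carrier := W\<rparr>)"
  have C: "submodule C R M"
    unfolding C_def by (rule submodule_cyclic[OF x(1)])
  have W: "submodule W R M" and LW: "L \<subseteq> W" and CW: "C \<subseteq> W"
    unfolding W_def using submodule_set_add[OF C L(1)] subset_set_add[OF C L(1)] by auto
  have Wc: "w \<in> carrier M" if "w \<in> W" for w
    using that submodule_subset[OF W] by auto
  have xW: "x \<in> W"
    using CW x(1) by (force simp: C_def image_iff)
  interpret L: abelian_subgroup L M
    using L(1) by (intro abelian_subgroupI3 additive_subgroup.intro M.abelian_group_axioms)
      (auto simp: submodule_def)
  have q_eq: "q v = q w \<longleftrightarrow> v \<ominus>\<^bsub>M\<^esub> w \<in> L" if "v \<in> carrier M" "w \<in> carrier M" for v w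
    using that L.a_rcos_module[OF that(2,1)]
      L.a_rcos_self[OF that(1)]
      L.a_repr_independence'[OF _ that(2)] inj_to_univ
    by (auto simp: q_def a_minus_def dest: injD)
  let ?W = "M\<lparr>carrier := W\<rparr>"
  have add: "q (v \<oplus>\<^bsub>?W\<^esub> u) = q (w \<oplus>\<^bsub>?W\<^esub> u)"
    if "v \<in> carrier ?W" "w \<in> carrier ?W" "u \<in> carrier ?W" "q v = q w" for u v w
  proof -
    have vwu: "v \<in> carrier M" "w \<in> carrier M" "u \<in> carrier M"
      using that(1-3) Wc by auto
    moreover have "v \<ominus>\<^bsub>M\<^esub> w \<in> L"
      using that(4) q_eq[OF vwu(1,2)] by simp
    ultimately show ?thesis
      by (simp add: q_eq minus_add_cancel_right)
  qed
  have smult: "q (r \<odot>\<^bsub>?W\<^esub> v) = q (r \<odot>\<^bsub>?W\<^esub> w)"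
    if "r \<in> carrier R" "v \<in> carrier ?W" "w \<in> carrier ?W" "q v = q w" for r v w
  proof -
    have vw: "v \<in> carrier M" "w \<in> carrier M"
      using that(2,3) Wc by auto
    moreover have "v \<ominus>\<^bsub>M\<^esub> w \<in> L"
      using that(4) q_eq[OF vw] by simp
    ultimately show ?thesis
      using submodule_smult[OF L(1) that(1)] that(1) by (simp add: q_eq flip: smult_r_minus)
  qed
  have S: "left_module R S"
    unfolding S_def
    by (rule image_module(1)[OF left_module_submodule[OF W]]) (rule add smult; assumption)+
  have q: "q \<in> module_hom R ?W S"
    unfolding S_def
    by (rule image_module(2)[OF left_module_submodule[OF W]]) (rule add smult; assumption)+
  have zero_S: "\<zero>\<^bsub>S\<^esub> = q \<zero>\<^bsub>M\<^esub>" and carrier_S: "carrier S = q ` W"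
    by (simp_all add: S_def)
  have q0: "q y = \<zero>\<^bsub>S\<^esub>" if "y \<in> L" for y
    using that q_eq[of y "\<zero>\<^bsub>M\<^esub>"] submodule_subset[OF L(1)] by (auto simp: zero_S minus_zero_right)
  have qx: "q x \<noteq> \<zero>\<^bsub>S\<^esub>"
    using x(1) L(3) q_eq[of x "\<zero>\<^bsub>M\<^esub>"] by (simp add: zero_S minus_zero_right)
  have "N = {\<zero>\<^bsub>S\<^esub>} \<or> N = carrier S" if N: "submodule N R S" for N
  proof -
    interpret S: left_module R S by fact
    \<comment> \<open>The preimage of \<open>N\<close> lies between \<open>L\<close> and
      \<open>W\<close>. If it contains \<open>x\<close>, it contains both summands of
      \<open>W\<close>; if not, maximality of \<open>L\<close> forces it to be
      \<open>L\<close>.\<close>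
    define H where "H = {w \<in> W. q w \<in> N}"
    have NS: "N \<subseteq> q ` W" "\<zero>\<^bsub>S\<^esub> \<in> N"
      using S.submodule_subset[OF N] S.submodule_zero[OF N] by (auto simp: carrier_S)
    have H: "submodule H R M"
      using submodule_vimage[OF left_module_submodule[OF W] S q _ N]
        left_module.submodule_carrier[OF left_module_submodule[OF W]]
      by (auto simp: H_def submodule_submodule_iff[OF W])
    have LH: "L \<subseteq> H"
      using LW q0 NS(2) by (auto simp: H_def)
    show ?thesis
    proof (cases "x \<in> H")
      case True
      have "C \<subseteq> H"
        using submodule_smult[OF H _ True] by (auto simp: C_def)
      then have "W \<subseteq> H"
        using LH submodule_add[OF H] by (auto simp: W_def set_add_def')
      then show ?thesis
        using NS(1) by (auto simp: H_def carrier_S)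
    next
      case False
      then have "H = L"
        by (rule Lmax[OF H LH])
      then have "N \<subseteq> {\<zero>\<^bsub>S\<^esub>}"
        using NS(1) q0 by (auto simp: H_def)
      then show ?thesis
        using NS(2) by auto
    qed
  qed
  moreover have "carrier S \<noteq> {\<zero>\<^bsub>S\<^esub>}"
    using xW qx module_hom_closed[OF q, of x] by auto
  ultimately have simple: "simple_module R S"
    using S by (simp add: simple_module_def)
  moreover have "in_sigma R M S"
    by (rule in_sigma_subfactor[OF S W q]) (simp add: carrier_S)
  ultimately have inj: "rel_injective R M S"
    using cs by (simp add: cosemisimple_def)
  then obtain g where g: "g \<in> module_hom R M S" "\<forall>w\<in>W. g w = q w"
    using W q unfolding rel_injective_def by blast
  show thesis
  proof (rule that[OF simple inj g(1)])
    show "g x \<noteq> \<zero>\<^bsub>S\<^esub>"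
      using g(2) xW qx by simp
    show "g y = \<zero>\<^bsub>S\<^esub>" if "y \<in> K" for y
      using g(2) q0[of y] that L(2) LW by auto
  qed
qed

section \<open>Endomorphisms that are nonzero on a submodule\<close>

lemma simple_module_surj:
  assumes S: "simple_module R S" and U: "submodule U R M"
    and p: "p \<in> module_hom R (M\<lparr>carrier := U\<rparr>) S" and u: "u \<in> U" "p u \<noteq> \<zero>\<^bsub>S\<^esub>"
  shows "p ` U = carrier S"
proof -
  have "left_module R S"
    using S by (simp add: simple_module_def)
  then have "submodule (p ` U) R S"
    using submodule_image[OF left_module_submodule[OF U] _ p]
      left_module.submodule_carrier[OF left_module_submodule[OF U]] by simp
  then have "p ` U = {\<zero>\<^bsub>S\<^esub>} \<or> p ` U = carrier S"
    using S unfolding simple_module_def by blast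
  moreover have "p ` U \<noteq> {\<zero>\<^bsub>S\<^esub>}"
    using u by blast
  ultimately show ?thesis
    by blast
qed

text \<open>
  Choose \<open>g : M \<rightarrow> S\<close> with \<open>S\<close> simple and \<open>g (f u) \<noteq> 0\<close>, and lift \<open>g\<close> along \<open>g \<circ> f : U \<rightarrow> S\<close> to
  \<open>k : M \<rightarrow> U\<close>. Then \<open>g \<circ> h = g\<close> for \<open>h = f \<circ> k\<close>, so no power of \<open>h\<close> vanishes, although \<open>h\<close> has an
  essential kernel and the kernels of its powers become stationary.
\<close>

lemma kernel_on_not_essential:
  assumes proj: "projective_in_sigma R M" and acc: "acc_left_annihilators R M"
    and cs: "cosemisimple R M" and U: "submodule U R M" and f: "f \<in> module_End R M"
    and u: "u \<in> U" "f u \<noteq> \<zero>\<^bsub>M\<^esub>"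
  obtains V where "submodule V R M" "V \<subseteq> U" "V \<noteq> {\<zero>\<^bsub>M\<^esub>}"
    "\<And>v. v \<in> V \<Longrightarrow> f v = \<zero>\<^bsub>M\<^esub> \<Longrightarrow> v = \<zero>\<^bsub>M\<^esub>"
proof -
  have fu: "f u \<in> carrier M" "f u \<notin> {\<zero>\<^bsub>M\<^esub>}"
    using u submodule_subset[OF U] module_hom_closed[OF f] by auto
  obtain S :: "('r, ('r, 'm) sigma_univ) module" and g
    where S: "simple_module R S" and g: "g \<in> module_hom R M S" and gfu: "g (f u) \<noteq> \<zero>\<^bsub>S\<^esub>"
    by (rule cosemisimple_separates[OF cs submodule_null fu])
  have LS: "left_module R S"
    using S by (simp add: simple_module_def)
  have gf: "(\<lambda>x. g (f x)) \<in> module_hom R (M\<lparr>carrier := U\<rparr>) S"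
    by (rule module_hom_restrict[OF module_hom_comp[OF f g] submodule_subset[OF U]])
  obtain k where k: "k \<in> module_End R M" "k ` carrier M \<subseteq> U"
    and gfk: "\<forall>x\<in>carrier M. g (f (k x)) = g x"
    using projective_lift[OF proj LS U gf simple_module_surj[OF S U gf u(1) gfu] g] by auto
  define h where "h = (\<lambda>x. f (k x))"
  have h: "h \<in> module_End R M"
    unfolding h_def by (rule module_hom_comp[OF k(1) f])
  note hn = module_hom_funpow[OF h]
  define Z where "Z = (\<lambda>n. {x \<in> carrier M. (h ^^ n) x = \<zero>\<^bsub>M\<^esub>})"
  have "left_annihilator R M (Z n)" for n
    unfolding left_annihilator_def using hn
    by (intro exI[of _ "{h ^^ n}"]) (auto simp: Z_def a_kernel_def')
  moreover have "Z n \<subseteq> Z (Suc n)" for n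
    using module_hom_zero[OF left_module_axioms left_module_axioms h] by (auto simp: Z_def)
  \<comment> \<open>Each \<open>Z n\<close> is the annihilator of a one-element set, so the chain
    condition applies.\<close>
  ultimately obtain n where "\<forall>m\<ge>n. Z m = Z n"
    using acc unfolding acc_left_annihilators_def by blast
  then have n: "Z (Suc n) = Z n"
    by (blast intro: le_SucI)
  have "g ((h ^^ m) x) = g x" if "x \<in> carrier M" for m x
    by (induction m) (use that gfk module_hom_closed[OF hn] in \<open>simp_all add: h_def\<close>)
  then have "g ((h ^^ n) (f u)) \<noteq> \<zero>\<^bsub>S\<^esub>"
    using fu gfu by simp
  then have nz: "(h ^^ n) (f u) \<noteq> \<zero>\<^bsub>M\<^esub>"
    using module_hom_zero[OF left_module_axioms LS g] by metis
  \<comment> \<open>A Fitting-type argument: as the kernels of the powers \<open>n\<close> and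
    \<open>Suc n\<close> agree, \<open>h\<close> is injective on the image of its
    \<open>n\<close>-th power.\<close>
  define Y where "Y = (h ^^ n) ` carrier M"
  have Y: "submodule Y R M"
    unfolding Y_def by (rule submodule_image[OF left_module_axioms left_module_axioms hn submodule_carrier])
  have h_inj: "y = \<zero>\<^bsub>M\<^esub>" if "y \<in> Y" "h y = \<zero>\<^bsub>M\<^esub>" for y
    using that n by (auto simp: Y_def Z_def)
  have k0: "k \<zero>\<^bsub>M\<^esub> = \<zero>\<^bsub>M\<^esub>"
    by (rule module_hom_zero[OF left_module_axioms left_module_axioms k(1)])
  show thesis
  proof (rule that[of "k ` Y"])
    show "submodule (k ` Y) R M"
      by (rule submodule_image[OF left_module_axioms left_module_axioms k(1) Y])
    show "k ` Y \<subseteq> U"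
      using k(2) submodule_subset[OF Y] by auto
    show "v = \<zero>\<^bsub>M\<^esub>" if "v \<in> k ` Y" "f v = \<zero>\<^bsub>M\<^esub>" for v
      using that h_inj k0 by (auto simp: h_def)
    have "(h ^^ n) (f u) \<in> Y"
      using fu by (auto simp: Y_def)
    moreover have "h ((h ^^ n) (f u)) \<noteq> \<zero>\<^bsub>M\<^esub>"
      using h_inj calculation nz by auto
    then have "k ((h ^^ n) (f u)) \<noteq> \<zero>\<^bsub>M\<^esub>"
      using module_hom_zero[OF left_module_axioms left_module_axioms f] by (auto simp: h_def)
    ultimately show "k ` Y \<noteq> {\<zero>\<^bsub>M\<^esub>}"
      by auto
  qed
qed

section \<open>Finitely many endomorphisms with values in a fully invariant submodule\<close>

text \<open>Let \<open>A\<close> be the joint kernel of all endomorphisms with values in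
  \<open>N\<close>. It is fully invariant, because precomposing such a map with any endomorphism
  gives another one, and its product with \<open>N\<close> is zero. As \<open>N\<close> is nonzero,
  primeness makes \<open>A\<close> zero, so it cannot contain \<open>x\<close>.\<close>

lemma prime_module_separates:
  assumes prime: "prime_module R M" and N: "fully_invariant R M N" "N \<noteq> {\<zero>\<^bsub>M\<^esub>}"
    and x: "x \<in> carrier M" "x \<noteq> \<zero>\<^bsub>M\<^esub>"
  obtains f where "f \<in> module_End R M" "f ` carrier M \<subseteq> N" "f x \<noteq> \<zero>\<^bsub>M\<^esub>"
proof (rule ccontr)
  assume "\<not> thesis"
  define A where "A = {y \<in> carrier M. \<forall>f\<in>module_End R M. f ` carrier M \<subseteq> N \<longrightarrow> f y = \<zero>\<^bsub>M\<^esub>}"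
  have NM: "N \<subseteq> carrier M" "\<zero>\<^bsub>M\<^esub> \<in> N"
    using N(1) submodule_subset submodule_zero by (auto simp: fully_invariant_def)
  have xA: "x \<in> A"
    using x \<open>\<not> thesis\<close> that by (auto simp: A_def)
  have "submodule A R M"
    using submodule_joint_kernel[OF left_module_axioms, of "{f \<in> module_End R M. f ` carrier M \<subseteq> N}"]
    by (simp add: A_def Ball_def imp_conjL)
  moreover have "g y \<in> A" if g: "g \<in> module_End R M" and y: "y \<in> A" for g y
  proof -
    have "f (g y) = \<zero>\<^bsub>M\<^esub>" if "f \<in> module_End R M" "f ` carrier M \<subseteq> N" for f
    proof -
      have "(\<lambda>x. f (g x)) \<in> module_End R M"
        by (rule module_hom_comp[OF g that(1)])
      moreover have "(\<lambda>x. f (g x)) ` carrier M \<subseteq> N"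
        using that(2) module_hom_closed[OF g] by blast
      ultimately show ?thesis
        using y unfolding A_def by blast
    qed
    moreover have "g y \<in> carrier M"
      using y module_hom_closed[OF g] by (simp add: A_def)
    ultimately show ?thesis
      by (simp add: A_def)
  qed
  ultimately have A: "fully_invariant R M A"
    unfolding fully_invariant_def by blast
  have "f ` A \<subseteq> {\<zero>\<^bsub>M\<^esub>}" if "f \<in> module_hom R M (M\<lparr>carrier := N\<rparr>)" for f
    using that by (auto simp: A_def module_hom_corestrict_iff[OF NM(1)])
  then have "\<Union>{f ` A | f. f \<in> module_hom R M (M\<lparr>carrier := N\<rparr>)} \<subseteq> {\<zero>\<^bsub>M\<^esub>}"
    by blast
  then have "submodule_product R M A N \<subseteq> {\<zero>\<^bsub>M\<^esub>}"
    unfolding submodule_product_def submodule_sum_def using submodule_null by blast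
  then have "A \<subseteq> {\<zero>\<^bsub>M\<^esub>} \<or> N \<subseteq> {\<zero>\<^bsub>M\<^esub>}"
    using prime A N(1) unfolding prime_module_def prime_submodule_def by blast
  then show False
    using xA x(2) N(2) NM(2) by auto
qed

section \<open>Uniform submodules and sums\<close>

lemma uniform_module_Int:
  assumes "uniform_module R (M\<lparr>carrier := U\<rparr>)" and U: "submodule U R M"
    and "submodule A R M" "A \<subseteq> U" "A \<noteq> {\<zero>\<^bsub>M\<^esub>}" and "submodule B R M" "B \<subseteq> U" "B \<noteq> {\<zero>\<^bsub>M\<^esub>}"
  shows "A \<inter> B \<noteq> {\<zero>\<^bsub>M\<^esub>}"
proof -
  have "essential_submodule R (M\<lparr>carrier := U\<rparr>) A"
    using assms(1,3-5) submodule_submodule_iff[OF U] by (simp add: uniform_module_def)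
  then show ?thesis
    using assms(6-8) submodule_submodule_iff[OF U] by (simp add: essential_submodule_def)
qed

text \<open>Such a \<open>W\<close> embeds into the uniform module \<open>U\<close> by projection along \<open>T\<close>.\<close>

lemma Int_nonzero_of_uniform_complement:
  assumes unif: "uniform_module R (M\<lparr>carrier := U\<rparr>)" and U: "submodule U R M"
    and T: "submodule T R M" and TU: "T \<inter> U = {\<zero>\<^bsub>M\<^esub>}"
    and W: "submodule W R M" "W \<subseteq> T <+>\<^bsub>M\<^esub> U" "W \<inter> T = {\<zero>\<^bsub>M\<^esub>}"
    and A: "submodule A R M" "A \<subseteq> W" "A \<noteq> {\<zero>\<^bsub>M\<^esub>}"
    and B: "submodule B R M" "B \<subseteq> W" "B \<noteq> {\<zero>\<^bsub>M\<^esub>}"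
  shows "A \<inter> B \<noteq> {\<zero>\<^bsub>M\<^esub>}"
proof -
  have Tc: "t \<in> carrier M" if "t \<in> T" for t
    using that submodule_subset[OF T] by auto
  have Uc: "v \<in> carrier M" if "v \<in> U" for v
    using that submodule_subset[OF U] by auto
  \<comment> \<open>For \<open>A\<close> inside the direct sum of \<open>T\<close> and
    \<open>U\<close>, this is the projection of \<open>A\<close> to \<open>U\<close> along
    \<open>T\<close>, written without a projection map.\<close>
  define P where "P = (\<lambda>A. (T <+>\<^bsub>M\<^esub> A) \<inter> U)"
  have P: "submodule (P A) R M" "P A \<subseteq> U" if "submodule A R M" for A
    using that U T by (auto simp: P_def intro!: submodule_Int submodule_set_add)
  have P_nz: "P A \<noteq> {\<zero>\<^bsub>M\<^esub>}" if A: "submodule A R M" "A \<subseteq> W" "A \<noteq> {\<zero>\<^bsub>M\<^esub>}" for A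
  proof -
    obtain a where a: "a \<in> A" "a \<noteq> \<zero>\<^bsub>M\<^esub>"
      using A submodule_zero by blast
    then obtain t v where tv: "t \<in> T" "v \<in> U" "a = t \<oplus>\<^bsub>M\<^esub> v"
      using A(2) W(2) by (auto simp: set_add_def' subset_iff)
    have "v = \<ominus>\<^bsub>M\<^esub> t \<oplus>\<^bsub>M\<^esub> a"
      using tv Tc Uc by (simp add: M.r_neg1)
    then have "v \<in> P A"
      using tv a(1) submodule_uminus[OF T tv(1)] by (auto simp: P_def set_add_def')
    moreover have "v \<noteq> \<zero>\<^bsub>M\<^esub>"
      using tv a A(2) W(3) Tc by auto
    ultimately show ?thesis
      by auto
  qed
  have "P A \<inter> P B \<noteq> {\<zero>\<^bsub>M\<^esub>}"
    by (rule uniform_module_Int[OF unif U P[OF A(1)] P_nz[OF A] P[OF B(1)] P_nz[OF B]])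
  moreover have "\<zero>\<^bsub>M\<^esub> \<in> P A \<inter> P B"
    using P submodule_zero A(1) B(1) by blast
  ultimately obtain v where v: "v \<in> P A" "v \<in> P B" "v \<noteq> \<zero>\<^bsub>M\<^esub>"
    by blast
  \<comment> \<open>A common projection \<open>v\<close> comes from some \<open>a\<close> in
    \<open>A\<close> and some \<open>b\<close> in \<open>B\<close> that differ by an element of
    \<open>T\<close>. Both lie in \<open>W\<close>, which meets \<open>T\<close> trivially, so they
    coincide.\<close>
  then obtain t a t' b where t: "t \<in> T" "t' \<in> T" and ab: "a \<in> A" "b \<in> B"
    and eq: "v = t \<oplus>\<^bsub>M\<^esub> a" "v = t' \<oplus>\<^bsub>M\<^esub> b" and vU: "v \<in> U"
    unfolding P_def set_add_def' by blast
  have abW: "a \<in> W" "b \<in> W" and abc: "a \<in> carrier M" "b \<in> carrier M"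
    using ab A B submodule_subset by auto
  have "a = \<ominus>\<^bsub>M\<^esub> t \<oplus>\<^bsub>M\<^esub> v" "b = \<ominus>\<^bsub>M\<^esub> t' \<oplus>\<^bsub>M\<^esub> v"
    using eq t Tc abc by (metis M.r_neg1)+
  then have "a \<ominus>\<^bsub>M\<^esub> b = t' \<ominus>\<^bsub>M\<^esub> t"
    using minus_add_cancel_right[of "\<ominus>\<^bsub>M\<^esub> t" "\<ominus>\<^bsub>M\<^esub> t'" v] t Tc Uc[OF vU]
    by (simp add: a_minus_def M.a_comm)
  then have "a \<ominus>\<^bsub>M\<^esub> b \<in> W \<inter> T"
    using submodule_minus[OF W(1) abW] submodule_minus[OF T t(2,1)] by simp
  then have "a = b"
    using W(3) abc by (simp add: minus_eq_zero_iff)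
  moreover have "a \<noteq> \<zero>\<^bsub>M\<^esub>"
  proof
    assume "a = \<zero>\<^bsub>M\<^esub>"
    then have "v = t"
      using eq(1) t(1) Tc by simp
    then show False
      using TU t(1) vU v(3) by blast
  qed
  ultimately show ?thesis
    using ab by auto
qed

lemma submodule_submodule_sum:
  assumes "\<And>N. N \<in> \<N> \<Longrightarrow> submodule N R M"
  shows "submodule (submodule_sum R M \<N>) R M"
proof -
  \<comment> \<open>This makes \<open>carrier M\<close> one of the intersected submodules, so the
    intersection stays inside the carrier.\<close>
  have "\<Union>\<N> \<subseteq> carrier M"
    using assms submodule_subset by blast
  then have "submodule_sum R M \<N> \<subseteq> carrier M"
    using submodule_carrier by (auto simp: submodule_sum_def)
  then show ?thesis
    unfolding submodule_iff[of "submodule_sum R M \<N>"]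
    by (auto simp: submodule_sum_def intro: submodule_zero submodule_add submodule_smult)
qed

section \<open>Reduction to finitely many endomorphisms\<close>

text \<open>Induction on the number of uniform summands: a finite \<open>F\<close> is built whose
  joint kernel meets the partial sum \<open>T j\<close> trivially, and passing to the next summand
  costs at most one more map. The full sum is essential, so a joint kernel meeting it trivially is
  zero.\<close>

lemma finite_separating_family:
  assumes proj: "projective_in_sigma R M" and cs: "cosemisimple R M"
    and goldie: "goldie_module R M"
    and H: "H \<subseteq> module_End R M"
    and sep: "\<forall>x\<in>carrier M. x \<noteq> \<zero>\<^bsub>M\<^esub> \<longrightarrow> (\<exists>f\<in>H. f x \<noteq> \<zero>\<^bsub>M\<^esub>)"
  shows "\<exists>F\<subseteq>H. finite F \<and> (\<forall>x\<in>carrier M. (\<forall>f\<in>F. f x = \<zero>\<^bsub>M\<^esub>) \<longrightarrow> x = \<zero>\<^bsub>M\<^esub>)"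
proof -
  have acc: "acc_left_annihilators R M"
    using goldie by (simp add: goldie_module_def)
  obtain n :: nat and U :: "nat \<Rightarrow> 'm set" where ind: "independent_family R M {..<n} U"
    and unif: "\<And>i. i < n \<Longrightarrow> uniform_module R (M\<lparr>carrier := U i\<rparr>)"
    and ess: "essential_submodule R M (submodule_sum R M (U ` {..<n}))"
    using goldie unfolding goldie_module_def has_uniform_dim_def by blast
  define T where "T = (\<lambda>j. submodule_sum R M (U ` {..<j}))"
  define Ker where "Ker = (\<lambda>F. {x \<in> carrier M. \<forall>f\<in>F. f x = \<zero>\<^bsub>M\<^esub>})"
  have U: "submodule (U i) R M" if "i < n" for i
    using ind that by (simp add: independent_family_def)
  have T: "submodule (T j) R M" if "j \<le> n" for j
    unfolding T_def using U that by (intro submodule_submodule_sum) auto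
  have Ker: "submodule (Ker F) R M" if "F \<subseteq> H" for F
    unfolding Ker_def using that H by (intro submodule_joint_kernel left_module_axioms) auto
  have "\<exists>F\<subseteq>H. finite F \<and> T j \<inter> Ker F = {\<zero>\<^bsub>M\<^esub>}" if "j \<le> n" for j
    using that
  proof (induction j)
    case 0
    have "T 0 \<subseteq> {\<zero>\<^bsub>M\<^esub>}"
      using submodule_null by (auto simp: T_def submodule_sum_def)
    then have "T 0 \<inter> Ker {} = {\<zero>\<^bsub>M\<^esub>}"
      using submodule_zero[OF T[of 0]] by (auto simp: Ker_def)
    then show ?case
      by blast
  next
    case (Suc j)
    then have j: "j < n"
      by simp
    then have Tj: "submodule (T j) R M"
      by (simp add: T)
    have TSj: "submodule (T (Suc j)) R M"
      using T Suc.prems .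
    from Suc obtain F where F: "F \<subseteq> H" "finite F" "T j \<inter> Ker F = {\<zero>\<^bsub>M\<^esub>}"
      by auto
    \<comment> \<open>Independence compares \<open>U j\<close> with the sum of all other summands;
      the partial sum \<open>T j\<close> is contained in that one.\<close>
    have "T j \<subseteq> submodule_sum R M (U ` ({..<n} - {j}))"
      using j unfolding T_def submodule_sum_def by (intro Inter_anti_mono) force
    then have TU: "T j \<inter> U j = {\<zero>\<^bsub>M\<^esub>}"
      using ind j submodule_zero[OF Tj] submodule_zero[OF U[OF j]]
      unfolding independent_family_def by blast
    define X where "X = T j <+>\<^bsub>M\<^esub> U j"
    have X: "submodule X R M" "T j \<subseteq> X" "U j \<subseteq> X"
      unfolding X_def using submodule_set_add[OF Tj U[OF j]] subset_set_add[OF Tj U[OF j]] by auto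
    have "U i \<subseteq> X" if "i < Suc j" for i
    proof (cases "i = j")
      case False
      then have "i < j"
        using that by simp
      then have "U i \<subseteq> T j"
        by (auto simp: T_def submodule_sum_def)
      then show ?thesis
        using X(2) by blast
    qed (use X(3) in simp)
    then have "\<Union>(U ` {..<Suc j}) \<subseteq> X"
      by blast
    then have TX: "T (Suc j) \<subseteq> X"
      using X(1) unfolding T_def submodule_sum_def by blast
    \<comment> \<open>The part of the enlarged sum not yet separated by \<open>F\<close>. It meets
      \<open>T j\<close> trivially by the induction hypothesis, so any two nonzero submodules of
      \<open>W\<close> meet.\<close>
    define W where "W = X \<inter> Ker F"
    have W: "submodule W R M"
      unfolding W_def using X(1) Ker[OF F(1)] by (rule submodule_Int)
    show ?case
    proof (cases "W = {\<zero>\<^bsub>M\<^esub>}")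
      case True
      then have "T (Suc j) \<inter> Ker F = {\<zero>\<^bsub>M\<^esub>}"
        using TX submodule_zero[OF TSj] submodule_zero[OF Ker[OF F(1)]] by (auto simp: W_def)
      then show ?thesis
        using F by blast
    next
      case False
      then obtain w where w: "w \<in> W" "w \<noteq> \<zero>\<^bsub>M\<^esub>"
        using submodule_zero[OF W] by blast
      then obtain f where f: "f \<in> H" "f w \<noteq> \<zero>\<^bsub>M\<^esub>"
        using sep submodule_subset[OF W] by blast
      have fE: "f \<in> module_End R M"
        using f(1) H by blast
      \<comment> \<open>\<open>V\<close> is nonzero and meets the kernel of \<open>f\<close> on
        \<open>W\<close> trivially, which forces this kernel to be zero. Hence adding
        \<open>f\<close> to \<open>F\<close> completes the induction step.\<close>
      obtain V where V: "submodule V R M" "V \<subseteq> W" "V \<noteq> {\<zero>\<^bsub>M\<^esub>}"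
        and fV: "\<And>v. v \<in> V \<Longrightarrow> f v = \<zero>\<^bsub>M\<^esub> \<Longrightarrow> v = \<zero>\<^bsub>M\<^esub>"
        by (rule kernel_on_not_essential[OF proj acc cs W fE w(1) f(2)]) blast
      have Q: "submodule (W \<inter> Ker {f}) R M"
        using Ker[of "{f}"] f(1) W by (auto intro: submodule_Int)
      have "V \<inter> (W \<inter> Ker {f}) = {\<zero>\<^bsub>M\<^esub>}"
        using fV submodule_zero[OF V(1)] submodule_zero[OF Q] by (auto simp: Ker_def)
      moreover have WT: "W \<inter> T j = {\<zero>\<^bsub>M\<^esub>}"
        using F(3) X(2) by (auto simp: W_def)
      moreover have WX: "W \<subseteq> T j <+>\<^bsub>M\<^esub> U j"
        by (simp add: W_def X_def)
      ultimately have "W \<inter> Ker {f} = {\<zero>\<^bsub>M\<^esub>}"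
        using Int_nonzero_of_uniform_complement[OF unif[OF j] U[OF j] Tj TU W WX WT V Q Int_lower1]
        by blast
      then have "T (Suc j) \<inter> Ker (insert f F) = {\<zero>\<^bsub>M\<^esub>}"
        using TX submodule_zero[OF TSj] submodule_zero[OF Ker[of "insert f F"]] f(1) F(1)
        by (auto simp: W_def Ker_def)
      then show ?thesis
        using F f(1) by (intro exI[of _ "insert f F"]) auto
    qed
  qed
  then obtain F where F: "F \<subseteq> H" "finite F" "T n \<inter> Ker F = {\<zero>\<^bsub>M\<^esub>}"
    by blast
  then have "Ker F = {\<zero>\<^bsub>M\<^esub>}"
    using ess Ker[OF F(1)] by (auto simp: essential_submodule_def T_def)
  then show ?thesis
    using F(1,2) by (intro exI[of _ F]) (auto simp: Ker_def)
qed

text \<open>By \<open>ker\<close>, the restriction of \<open>g\<close> to \<open>W\<close> factors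
  through the image of \<open>W\<close> under \<open>f\<close>. The resulting map on this submodule
  of \<open>M\<close> extends to \<open>M\<close> by injectivity of \<open>S\<close>.\<close>

lemma rel_injective_factor:
  assumes inj: "rel_injective R M S" and S: "left_module R S" and W: "submodule W R M"
    and f: "f \<in> module_End R M" and g: "g \<in> module_hom R M S"
    and ker: "\<And>w. w \<in> W \<Longrightarrow> f w = \<zero>\<^bsub>M\<^esub> \<Longrightarrow> g w = \<zero>\<^bsub>S\<^esub>"
  obtains h where "h \<in> module_hom R M S" "\<And>w. w \<in> W \<Longrightarrow> h (f w) = g w"
proof -
  interpret S: left_module R S by fact
  have Wc: "w \<in> carrier M" if "w \<in> W" for w
    using that submodule_subset[OF W] by auto
  \<comment> \<open>The induced map on the image of \<open>W\<close>, defined by a chosen preimage;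
    two preimages differ by an element of the kernel of \<open>f\<close> on \<open>W\<close>, where
    \<open>g\<close> vanishes.\<close>
  define q where "q = (\<lambda>y. g (inv_into W f y))"
  have q: "q (f w) = g w" if w: "w \<in> W" for w
  proof -
    let ?v = "inv_into W f (f w)"
    have v: "?v \<in> W" "f ?v = f w"
      using w by (auto intro: inv_into_into f_inv_into_f)
    then have "f (?v \<ominus>\<^bsub>M\<^esub> w) = \<zero>\<^bsub>M\<^esub>"
      using w Wc f module_hom_minus[OF left_module_axioms f]
      by (simp add: minus_eq_zero_iff module_hom_closed)
    then have "g (?v \<ominus>\<^bsub>M\<^esub> w) = \<zero>\<^bsub>S\<^esub>"
      using ker submodule_minus[OF W v(1) w] by blast
    then show ?thesis
      using v w Wc g module_hom_minus[OF S g]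
      by (simp add: q_def S.minus_eq_zero_iff module_hom_closed)
  qed
  have "q \<in> module_hom R (M\<lparr>carrier := f ` W\<rparr>) S"
    using q Wc f g submodule_add[OF W] submodule_smult[OF W]
    by (simp add: module_hom_iff flip: module_hom_add[OF f] module_hom_smult[OF f])
  moreover have "submodule (f ` W) R M"
    by (rule submodule_image[OF left_module_axioms left_module_axioms f W])
  ultimately obtain h where h: "h \<in> module_hom R M S" "\<forall>y\<in>f ` W. h y = q y"
    using inj unfolding rel_injective_def by blast
  show thesis
    by (rule that[OF h(1)]) (simp add: h(2) q)
qed

end

section \<open>Contradiction from a proper fully invariant submodule\<close>

theorem proposition4p6:
  fixes R :: "('r, 'z) ring_scheme" and M :: "('r, 'm, 'w) module_scheme"
  assumes "left_module R M"
    and "projective_in_sigma R M"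
    and "prime_module R M"
    and "goldie_module R M"
    and "cosemisimple R M"
  shows "FI_simple R M"
proof (rule ccontr)
  interpret left_module R M by fact
  assume "\<not> FI_simple R M"
  then obtain N where N: "fully_invariant R M N" "N \<noteq> {\<zero>\<^bsub>M\<^esub>}" "N \<noteq> carrier M"
    by (auto simp: FI_simple_def)
  then have subN: "submodule N R M" and invN: "\<And>f. f \<in> module_End R M \<Longrightarrow> f ` N \<subseteq> N"
    by (auto simp: fully_invariant_def)
  obtain x where x: "x \<in> carrier M" "x \<notin> N"
    using N(3) submodule_subset[OF subN] by blast
  obtain S :: "('r, ('r, 'm) sigma_univ) module" and g
    where S: "simple_module R S" and inj: "rel_injective R M S" and g: "g \<in> module_hom R M S"
      and gx: "g x \<noteq> \<zero>\<^bsub>S\<^esub>" and gN: "\<And>y. y \<in> N \<Longrightarrow> g y = \<zero>\<^bsub>S\<^esub>"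
    by (rule cosemisimple_separates[OF assms(5) subN x]) blast
  have LS: "left_module R S"
    using S by (simp add: simple_module_def)
  define H where "H = {f \<in> module_End R M. f ` carrier M \<subseteq> N}"
  \<comment> \<open>Here \<open>h\<close> lifts along the surjection \<open>g\<close> to an
    endomorphism \<open>k\<close>. Full invariance keeps \<open>k (f y)\<close> in \<open>N\<close>,
    where \<open>g\<close> vanishes.\<close>
  have zero: "h (f y) = \<zero>\<^bsub>S\<^esub>" if h: "h \<in> module_hom R M S" and f: "f \<in> H" and y: "y \<in> carrier M"
    for h f y
  proof -
    have g': "g \<in> module_hom R (M\<lparr>carrier := carrier M\<rparr>) S"
      using g by simp
    obtain k where k: "k \<in> module_End R M" "\<forall>z\<in>carrier M. g (k z) = h z"
      using projective_lift[OF assms(2) LS submodule_carrier g'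
          simple_module_surj[OF S submodule_carrier g' x(1) gx] h] by auto
    have "f y \<in> N" "f y \<in> carrier M"
      using f y submodule_subset[OF subN] by (auto simp: H_def)
    then show ?thesis
      using k invN[OF k(1)] gN by (metis image_subset_iff)
  qed
  have "\<exists>f\<in>H. f y \<noteq> \<zero>\<^bsub>M\<^esub>" if "y \<in> carrier M" "y \<noteq> \<zero>\<^bsub>M\<^esub>" for y
    by (rule prime_module_separates[OF assms(3) N(1,2) that]) (auto simp: H_def)
  moreover have "H \<subseteq> module_End R M"
    by (auto simp: H_def)
  ultimately have "\<exists>F\<subseteq>H. finite F \<and> (\<forall>y\<in>carrier M. (\<forall>f\<in>F. f y = \<zero>\<^bsub>M\<^esub>) \<longrightarrow> y = \<zero>\<^bsub>M\<^esub>)"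
    by (intro finite_separating_family[OF assms(2,5,4)] ballI impI)
  then obtain F where F: "finite F" "F \<subseteq> H"
    and F0: "\<forall>y\<in>carrier M. (\<forall>f\<in>F. f y = \<zero>\<^bsub>M\<^esub>) \<longrightarrow> y = \<zero>\<^bsub>M\<^esub>"
    by blast
  \<comment> \<open>The induction shows that \<open>g\<close> is nonzero on the joint kernel of any
    finite part of \<open>H\<close>. For the empty family this kernel is all of \<open>M\<close>,
    and \<open>x\<close> is a witness.\<close>
  have "\<exists>y\<in>carrier M. (\<forall>f\<in>F. f y = \<zero>\<^bsub>M\<^esub>) \<and> g y \<noteq> \<zero>\<^bsub>S\<^esub>"
    using F
  proof (induction F rule: finite_induct)
    case empty
    then show ?case
      using x gx by blast
  next
    case (insert f F)
    define W where "W = {y \<in> carrier M. \<forall>f\<in>F. f y = \<zero>\<^bsub>M\<^esub>}"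
    have f: "f \<in> module_End R M" and FE: "\<And>f. f \<in> F \<Longrightarrow> f \<in> module_End R M"
      using insert.prems by (auto simp: H_def)
    have W: "submodule W R M"
      unfolding W_def using FE by (intro submodule_joint_kernel left_module_axioms) auto
    show ?case
    proof (rule ccontr)
      assume "\<not> ?case"
      then have ker: "g w = \<zero>\<^bsub>S\<^esub>" if "w \<in> W" "f w = \<zero>\<^bsub>M\<^esub>" for w
        using that unfolding W_def by blast
      \<comment> \<open>On \<open>W\<close> the map \<open>g\<close> is the composite of
        \<open>f\<close> and \<open>h\<close>, which is zero because \<open>f\<close> belongs to
        \<open>H\<close>; this contradicts the induction hypothesis.\<close>
      obtain h where h: "h \<in> module_hom R M S" "\<And>w. w \<in> W \<Longrightarrow> h (f w) = g w"
        by (rule rel_injective_factor[OF inj LS W f g ker]) blast+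
      have "g w = \<zero>\<^bsub>S\<^esub>" if "w \<in> W" for w
        using zero[OF h(1), of f w] h(2)[OF that] that insert.prems by (simp add: W_def)
      then show False
        using insert.IH insert.prems unfolding W_def by blast
    qed
  qed
  \<comment> \<open>The witness is zero, being in the joint kernel of \<open>F\<close>, yet
    \<open>g\<close> does not vanish at it.\<close>
  then show False
    using F0 module_hom_zero[OF left_module_axioms LS g] by metis
qed

end
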